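(* Let $u_1,\dots,u_M,v_1,\dots,v_N\in\mathbb{C}$ be such that $$\left|\frac{u_i-s}{1-su_i}\cdot\frac{v_j-s}{1-sv_j}\right|<1,\qquad 1\le i\le M,\ 1\le j\le N.$$ Then for any nonnegative signatures $\lambda$ and $\mu$, $$\sum_\nu F_{\nu/\lambda}(u_1,\dots,u_M)\,G^c_{\nu/\mu}(v_1,\dots,v_N)=\prod_{\substack{1\le i\le M\\1\le j\le N}}\frac{1-qu_iv_j}{1-u_iv_j}\ \sum_\kappa G^c_{\lambda/\kappa}(v_1,\dots,v_N)\,F_{\mu/\kappa}(u_1,\dots,u_M),$$ where both summations are over the set of all nonnegative signatures (of all lengths, including the empty signature).
   Context: Throughout, $q,s$ are fixed generic complex parameters, and variables are such that no denominator vanishes. $(a;q)_n=\prod_{r=0}^{n-1}(1-aq^r)$ for $n\ge1$, $(a;q)_0=1$. Signatures: a signature of length $L$ is a string of integers $\lambda=(\lambda_1\ge\dots\ge\lambda_L)$; $\mathrm{Sign}_L$ is the set of all of them, $\mathrm{Sign}_L^+$ those with nonnegative entries; $\mathrm{Sign}_0=\mathrm{Sign}_0^+=\{\varnothing\}$. The set of all nonnegative signatures is $\bigsqcup_{L\ge0}\mathrm{Sign}_L^+$. Multiplicative notation: $\lambda=0^{m_0}1^{m_1}2^{m_2}\cdots$ with $m_j=|\{i:\lambda_i=j\}|$. Vertex weights: for $u\in\mathbb{C}$ and integers $m\ge 0$, $w_u(m,0;m,0)=\frac{1-sq^mu}{1-su}$, $w_u(m,1;m,1)=\frac{u-sq^m}{1-su}$,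 $w_u(m+1,0;m,1)=\frac{(1-s^2q^m)u}{1-su}$, $w_u(m,1;m+1,0)=\frac{1-q^{m+1}}{1-su}$, and $w_u(i_1,j_1;i_2,j_2)=0$ for all other nonnegative integers. Path weights: in the square grid, assign to each vertex $(i,j)$ the variable $u_j$ (constant along rows). A vertex is interior to an up-right path if it lies on the path and is not its beginning or ending vertex. The weight of a finite collection of up-right paths is the product, over all vertices interior to the paths of the collection, of $w_{u_j}(i_1,j_1;i_2,j_2)$, where $i_1,j_1,i_2,j_2$ are the numbers of paths of the collection containing the South, West, North, East edge at the vertex (weight $1$ if there are no interior vertices). Two collections are identified if they have the same interior vertices and the same numbers $(i_1,j_1,i_2,j_2)$ at each of them. $F$: for $L\ge M\ge0$, $\lambda\in\mathrm{Sign}^+_L$, $\mu\in\mathrm{Sign}^+_M$, $F_{\lambda/\mu}(u_1,\dots,u_{L-M})$ is the sum of weights of all collections of $L$ up-right paths that start with the vertical edges $(\mu_m,0)\to(\mu_m,1)$, $1\le m\le M$, and the horizontal edges $(-1,j)\to(0,j)$, $1\le j\le L-M$, and end with the vertical edges $(\lambda_l,L-M)\to(\lambda_l,L-M+1)$, $1\le l\le L$. By convention $F_{\lambda/\mu}$ of $r$ variables is $0$ unless the length of $\lambda$ equals the length of $\mu$ plus $r$. $G$: for $L,k\ge0$, $\lambda,\nu\in\mathrm{Sign}_L$, $G_{\lambda/\nu}(u_1,\dots,u_k)$ is the sum of weights of all collections of $L$ up-right paths that start with the vertical edges $(\nu_n,0)\to(\nu_n,1)$, $1\le n\le L$, and end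 with the vertical edges $(\lambda_l,k)\to(\lambda_l,k+1)$, $1\le l\le L$. By convention $G_{\lambda/\nu}=0$ if $\lambda,\nu$ have different lengths. Conjugation: for $\nu=0^{n_0}1^{n_1}2^{n_2}\cdots$ put $c(\nu)=\prod_{k\ge0}\frac{(s^2;q)_{n_k}}{(q;q)_{n_k}}$, and $G^c_{\lambda/\mu}=\frac{c(\lambda)}{c(\mu)}G_{\lambda/\mu}$. *)

theory Defs
  imports
    "HOL-Analysis.Analysis"
    "HOL-Library.Multiset"
    "HOL-Library.Groups_Big_Fun"
begin

definition q_pochhammer :: "complex \<Rightarrow> complex \<Rightarrow> nat \<Rightarrow> complex" where
  "q_pochhammer a q n = (\<Prod>r<n. 1 - a * q ^ r)"

definition signatures :: "nat \<Rightarrow> int list set" where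
  "signatures L = {lam. length lam = L \<and> sorted_wrt (\<ge>) lam}"

definition nonneg_signatures :: "int list set" where
  "nonneg_signatures = (\<Union>L. {lam \<in> signatures L. \<forall>x\<in>set lam. x \<ge> 0})"

text \<open>The weight of a vertex with \<open>i1, j1, i2, j2\<close> paths through its South, West, North and
  East edge, respectively.\<close>

definition vertex_weight ::
  "complex \<Rightarrow> complex \<Rightarrow> complex \<Rightarrow> nat \<Rightarrow> nat \<Rightarrow> nat \<Rightarrow> nat \<Rightarrow> complex" where
  "vertex_weight q s u i1 j1 i2 j2 =
    (if j1 = 0 \<and> j2 = 0 \<and> i1 = i2 then (1 - s * q ^ i1 * u) / (1 - s * u)
     else if j1 = 1 \<and> j2 = 1 \<and> i1 = i2 then (u - s * q ^ i1) / (1 - s * u)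
     else if j1 = 0 \<and> j2 = 1 \<and> i1 = i2 + 1 then (1 - s\<^sup>2 * q ^ i2) * u / (1 - s * u)
     else if j1 = 1 \<and> j2 = 0 \<and> i2 = i1 + 1 then (1 - q ^ (i1 + 1)) / (1 - s * u)
     else 0)"

type_synonym vertex = "int \<times> int"
type_synonym edge = "vertex \<times> vertex"

definition unit_step :: "vertex \<Rightarrow> vertex \<Rightarrow> bool" where
  "unit_step a b \<longleftrightarrow> b = (fst a + 1, snd a) \<or> b = (fst a, snd a + 1)"

text \<open>A path is the list of its vertices and has at least one edge.\<close>

definition up_right_path :: "vertex list \<Rightarrow> bool" where
  "up_right_path p \<longleftrightarrow> length p \<ge> 2 \<and> successively unit_step p"

definition edges :: "vertex list \<Rightarrow> edge list" where
  "edges p = zip p (tl p)"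

text \<open>Several paths may share edges, or even coincide, so a collection of paths is a multiset;
  prescribed first and last edges are likewise multisets.  The order in which the first edges
  are joined to the last ones is not prescribed.\<close>

definition collections :: "edge multiset \<Rightarrow> edge multiset \<Rightarrow> vertex list multiset set" where
  "collections A B = {C. (\<forall>p\<in>#C. up_right_path p) \<and>
     image_mset (\<lambda>p. hd (edges p)) C = A \<and> image_mset (\<lambda>p. last (edges p)) C = B}"

definition interior_vertices :: "vertex list multiset \<Rightarrow> vertex set" where
  "interior_vertices C = (\<Union>p\<in>set_mset C. set p - {hd p, last p})"

definition num_through :: "vertex list multiset \<Rightarrow> edge \<Rightarrow> nat" where
  "num_through C e = size {#p \<in># C. e \<in> set (edges p)#}"

text \<open>The local data of a collection: a partial map, defined exactly at the interior vertices,
  giving the numbers \<open>(i1, j1, i2, j2)\<close> there.  Two collections are identified iff they have the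
  same local data, so that summing over collections up to identification means summing over
  local data of collections.\<close>

definition local_data ::
  "vertex list multiset \<Rightarrow> (vertex \<rightharpoonup> nat \<times> nat \<times> nat \<times> nat)" where
  "local_data C = (\<lambda>(x, y).
     if (x, y) \<in> interior_vertices C then
       Some (num_through C ((x, y - 1), (x, y)), num_through C ((x - 1, y), (x, y)),
             num_through C ((x, y), (x, y + 1)), num_through C ((x, y), (x + 1, y)))
     else None)"

definition weight ::
  "complex \<Rightarrow> complex \<Rightarrow> (nat \<Rightarrow> complex) \<Rightarrow> (vertex \<rightharpoonup> nat \<times> nat \<times> nat \<times> nat) \<Rightarrow> complex" where
  "weight q s u d = (\<Prod>v\<in>dom d. case the (d v) of (i1, j1, i2, j2) \<Rightarrow>
     vertex_weight q s (u (nat (snd v))) i1 j1 i2 j2)"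

definition partition_function ::
  "complex \<Rightarrow> complex \<Rightarrow> (nat \<Rightarrow> complex) \<Rightarrow> edge multiset \<Rightarrow> edge multiset \<Rightarrow> complex" where
  "partition_function q s u A B = (\<Sum>d\<in>local_data ` collections A B. weight q s u d)"

definition vertical_edges :: "int list \<Rightarrow> int \<Rightarrow> edge multiset" where
  "vertical_edges lam y = image_mset (\<lambda>x. ((x, y), (x, y + 1))) (mset lam)"

definition left_edges :: "nat \<Rightarrow> edge multiset" where
  "left_edges r = image_mset (\<lambda>j. ((-1, int j), (0, int j))) (mset_set {1..r})"

text \<open>\<open>F_skew q s r u lam mu\<close> is $F_{\lambda/\mu}(u_1,\dots,u_r)$ and \<open>G_skew q s k u lam nu\<close> is
  $G_{\lambda/\nu}(u_1,\dots,u_k)$.\<close>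

definition F_skew ::
  "complex \<Rightarrow> complex \<Rightarrow> nat \<Rightarrow> (nat \<Rightarrow> complex) \<Rightarrow> int list \<Rightarrow> int list \<Rightarrow> complex" where
  "F_skew q s r u lam mu =
    (if length lam = length mu + r
     then partition_function q s u (vertical_edges mu 0 + left_edges r) (vertical_edges lam (int r))
     else 0)"

definition G_skew ::
  "complex \<Rightarrow> complex \<Rightarrow> nat \<Rightarrow> (nat \<Rightarrow> complex) \<Rightarrow> int list \<Rightarrow> int list \<Rightarrow> complex" where
  "G_skew q s k u lam nu =
    (if length lam = length nu
     then partition_function q s u (vertical_edges nu 0) (vertical_edges lam (int k))
     else 0)"

text \<open>$c(\nu)$; all but finitely many factors below are \<open>1\<close>, so \<open>Prod_any\<close> is the product over all
  $k \ge 0$.\<close>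

definition conj_factor :: "complex \<Rightarrow> complex \<Rightarrow> int list \<Rightarrow> complex" where
  "conj_factor q s nu = Prod_any (\<lambda>k::nat.
     q_pochhammer (s\<^sup>2) q (count_list nu (int k)) / q_pochhammer q q (count_list nu (int k)))"

definition G_conj ::
  "complex \<Rightarrow> complex \<Rightarrow> nat \<Rightarrow> (nat \<Rightarrow> complex) \<Rightarrow> int list \<Rightarrow> int list \<Rightarrow> complex" where
  "G_conj q s k u lam mu = conj_factor q s lam / conj_factor q s mu * G_skew q s k u lam mu"

text \<open>Genericity of the parameters: all factors of $(q;q)_n$ and $(s^2;q)_n$ are nonzero.\<close>

definition generic :: "complex \<Rightarrow> complex \<Rightarrow> bool" where
  "generic q s \<longleftrightarrow> (\<forall>n\<ge>1. q ^ n \<noteq> 1) \<and> (\<forall>n. s\<^sup>2 * q ^ n \<noteq> 1)"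

end

theory Submission
  imports Defs
begin

text \<open>A collection of paths is the same thing as a sequence of rows of vertices, so \<open>F\<close> and \<open>G\<close> are
  iterated one-row transfer kernels between multisets of positions.  For a single \<open>u\<close>-row and a single
  \<open>v\<close>-row the two sides of the identity, cut off after \<open>n\<close> columns, are related by a six-vertex
  R-matrix, by induction on \<open>n\<close>.  On the right boundary this gives the identity up to a term in which
  a path of each row leaves the first \<open>n\<close> columns; every further empty column multiplies that term by
  $\frac{u-s}{1-su}\cdot\frac{v-s}{1-sv}$, so it vanishes in the limit.  The general case follows by
  exchanging the rows one pair at a time.  The sums may be interchanged because a row kernel from
  \<open>A\<close> to \<open>B\<close> is bounded by a multiple of $t^{|B|-|A|}$ for every
  $t > \left|\frac{u-s}{1-su}\right|$.\<close>

section \<open>Rows of vertices\<close>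

text \<open>Within a row the horizontal edges are not free: conservation determines them from the
  vertical edges below and above. A state between two rows is therefore just a finite multiset of
  columns. Since c is a product over columns, the conjugation factor splits over vertices too, so
  G^c is a vertex model of the same kind and an exchange relation can be checked one column at a
  time.

  The two sides differ in nature. The lower state kappa is bounded by lambda, so the right-hand sum
  is finite, while the upper state nu is unbounded. On finitely many columns the exchange is pure
  algebra; the norm condition enters when the number of columns tends to infinity and when sums are
  interchanged. It bounds only products of a u-ratio and a v-ratio: one of the two may exceed 1, and
  then the bound for a single kernel grows with its upper state. Hence the kernel bounds allow
  arbitrary positive rates, and only products of a rate for \<open>F\<close> with a rate for
  \<open>G\<close> are kept below 1.\<close>

definition lt_count :: "nat multiset \<Rightarrow> nat \<Rightarrow> nat" where
  "lt_count A n = size {#x \<in># A. x < n#}"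

text \<open>The number of paths through the edge entering column \<open>x\<close> from the left, in a row with \<open>b\<close> paths
  entering at the far left, vertical edges \<open>A\<close> below and \<open>B\<close> above.  The truncated subtraction is
  exact when \<open>admissible b A B\<close> holds.\<close>

definition flux :: "nat \<Rightarrow> nat multiset \<Rightarrow> nat multiset \<Rightarrow> nat \<Rightarrow> nat" where
  "flux b A B x = b + lt_count A x - lt_count B x"

text \<open>These are the pairs of states that paths can realise: the inequalities say that the flux
  never becomes negative, the equality of sizes that no path runs off to the right.\<close>

definition admissible :: "nat \<Rightarrow> nat multiset \<Rightarrow> nat multiset \<Rightarrow> bool" where
  "admissible b A B \<longleftrightarrow> size B = size A + b \<and> (\<forall>x. lt_count B x \<le> b + lt_count A x)"

text \<open>The limit \<open>sum_mset B\<close> is a crude but explicit bound on the entries of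
  \<open>B\<close>, so the product covers every column that carries a path. If the empty vertex has
  weight 1, longer ranges give the same value.\<close>

definition row_weight :: "(nat \<Rightarrow> nat \<Rightarrow> nat \<Rightarrow> nat \<Rightarrow> complex) \<Rightarrow> nat \<Rightarrow> nat multiset \<Rightarrow> nat multiset \<Rightarrow> complex" where
  "row_weight W b A B = (if admissible b A B
     then \<Prod>x\<le>sum_mset B. W (count A x) (flux b A B x) (count B x) (flux b A B (Suc x)) else 0)"

lemma lt_count_0 [simp]: "lt_count A 0 = 0"
  by (simp add: lt_count_def)

lemma lt_count_Suc: "lt_count A (Suc n) = lt_count A n + count A n"
proof -
  have "{#x \<in># A. x < Suc n#} = {#x \<in># A. x < n#} + {#x \<in># A. x = n#}"
    by (rule multiset_eqI) auto
  then show ?thesis by (simp add: lt_count_def filter_eq_replicate_mset)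
qed

lemma lt_count_union: "lt_count (A + B) n = lt_count A n + lt_count B n"
  by (simp add: lt_count_def)

lemma lt_count_le_size: "lt_count A n \<le> size A"
  by (simp add: lt_count_def size_filter_mset_lesseq)

lemma lt_count_eq_size_iff: "lt_count A n = size A \<longleftrightarrow> set_mset A \<subseteq> {..<n}"
proof
  assume "lt_count A n = size A"
  then have "{#x \<in># A. x < n#} = A"
    unfolding lt_count_def
    using multiset_filter_subset[of "\<lambda>x. x < n" A] mset_subset_size[of "{#x \<in># A. x < n#}" A]
    by (auto simp: subset_mset.le_less)
  then show "set_mset A \<subseteq> {..<n}"
    by (auto simp: filter_mset_eq_conv)
next
  assume "set_mset A \<subseteq> {..<n}"
  then have "{#x \<in># A. x < n#} = A" by (auto simp: filter_mset_eq_conv)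
  then show "lt_count A n = size A" by (simp add: lt_count_def)
qed

lemma subset_sum_mset: "set_mset A \<subseteq> {..<Suc (sum_mset A)}"
proof
  fix x assume "x \<in># A"
  then have "A = add_mset x (A - {#x#})" by simp
  then have "sum_mset A = x + sum_mset (A - {#x#})" by (metis sum_mset.add_mset)
  then show "x \<in> {..<Suc (sum_mset A)}" by simp
qed

text \<open>Paths move only to the right, so the upper state bounds the lower one. This
  one-sidedness makes all sums over lower states finite.\<close>

lemma admissible_support:
  assumes "admissible b A B" "set_mset B \<subseteq> {..<n}" 
  shows "set_mset A \<subseteq> {..<n}"
proof -
  have "lt_count B n \<le> b + lt_count A n" using assms(1) by (simp add: admissible_def)
  then have "size A \<le> lt_count A n"
    using assms lt_count_eq_size_iff[of B n] by (simp add: admissible_def)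
  then show ?thesis using lt_count_eq_size_iff[of A n] lt_count_le_size[of A n] by simp
qed

lemma flux_eq_0:
  assumes "admissible b A B" "set_mset B \<subseteq> {..<n}"
  shows "flux b A B n = 0"
  using admissible_support[OF assms] assms lt_count_eq_size_iff[of A n] lt_count_eq_size_iff[of B n]
  by (simp add: admissible_def flux_def)

lemma row_eq:
  assumes "admissible b A B" "set_mset B \<subseteq> {..<n}" "W 0 0 0 0 = 1"
  shows "row_weight W b A B = (\<Prod>x<n. W (count A x) (flux b A B x) (count B x) (flux b A B (Suc x)))"
proof -
  have 1: "W (count A x) (flux b A B x) (count B x) (flux b A B (Suc x)) = 1"
    if "set_mset B \<subseteq> {..<m}" "x \<ge> m" for x m
  proof -
    have "set_mset B \<subseteq> {..<x}" "set_mset B \<subseteq> {..<Suc x}" using that by auto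
    moreover have "count A x = 0" "count B x = 0"
      using that admissible_support[OF assms(1) that(1)] by (auto simp: count_eq_zero_iff)
    ultimately show ?thesis using flux_eq_0[OF assms(1)] assms(3) by simp
  qed
  define k where "k = max n (Suc (sum_mset B))"
  have "(\<Prod>x<m. W (count A x) (flux b A B x) (count B x) (flux b A B (Suc x))) =
     (\<Prod>x<k. W (count A x) (flux b A B x) (count B x) (flux b A B (Suc x)))"
    if "set_mset B \<subseteq> {..<m}" "m \<le> k" for m
    by (rule prod.mono_neutral_left) (use that 1 in auto)
  from this[of n] this[of "Suc (sum_mset B)"] show ?thesis
    using assms subset_sum_mset by (auto simp: row_weight_def k_def lessThan_Suc_atMost)
qed

definition below :: "nat \<Rightarrow> nat multiset \<Rightarrow> nat multiset set" where
  "below b B = {C. admissible b C B}"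

lemma finite_bounded_multisets: "finite {A :: nat multiset. set_mset A \<subseteq> {..<n} \<and> size A \<le> k}"
proof -
  have "{A :: nat multiset. set_mset A \<subseteq> {..<n} \<and> size A \<le> k} \<subseteq> mset ` {xs. set xs \<subseteq> {..<n} \<and> length xs \<le> k}"
  proof
    fix A :: "nat multiset" assume A: "A \<in> {A. set_mset A \<subseteq> {..<n} \<and> size A \<le> k}"
    obtain xs where "A = mset xs" by (metis ex_mset)
    with A show "A \<in> mset ` {xs. set xs \<subseteq> {..<n} \<and> length xs \<le> k}" by auto
  qed
  moreover have "finite {xs :: nat list. set xs \<subseteq> {..<n} \<and> length xs \<le> k}"
    by (rule finite_lists_length_le) auto
  ultimately show ?thesis using finite_subset by blast
qed

lemma finite_below: "finite (below b B)"
proof (rule finite_subset[OF _ finite_bounded_multisets])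
  show "below b B \<subseteq> {A. set_mset A \<subseteq> {..<Suc (sum_mset B)} \<and> size A \<le> size B}"
    using admissible_support[OF _ subset_sum_mset] by (auto simp: below_def admissible_def)
qed

fun transfer_kernel :: "(nat \<Rightarrow> nat \<Rightarrow> nat \<Rightarrow> nat \<Rightarrow> nat \<Rightarrow> complex) \<Rightarrow> nat \<Rightarrow> nat \<Rightarrow> nat multiset \<Rightarrow> nat multiset \<Rightarrow> complex" where
  "transfer_kernel W b 0 A B = (if A = B then 1 else 0)"
| "transfer_kernel W b (Suc r) A B = (\<Sum>C\<in>below b B. transfer_kernel W b r A C * row_weight (W (Suc r)) b C B)"

section \<open>The Yang-Baxter relation\<close>

text \<open>The conjugation factor $c(\lambda)/c(\mu)$ distributed over the vertices of a row.\<close>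

definition conj_weight ::
  "complex \<Rightarrow> complex \<Rightarrow> complex \<Rightarrow> nat \<Rightarrow> nat \<Rightarrow> nat \<Rightarrow> nat \<Rightarrow> complex" where
  "conj_weight q s u i1 j1 i2 j2 =
    (q_pochhammer (s\<^sup>2) q i2 / q_pochhammer q q i2) / (q_pochhammer (s\<^sup>2) q i1 / q_pochhammer q q i1)
     * vertex_weight q s u i1 j1 i2 j2"

lemma q_pochhammer_Suc: "q_pochhammer a q (Suc n) = q_pochhammer a q n * (1 - a * q ^ n)"
  by (simp add: q_pochhammer_def)

lemma q_pochhammer_nonzero:
  assumes "generic q s"
  shows "q_pochhammer q q n \<noteq> 0" "q_pochhammer (s\<^sup>2) q n \<noteq> 0"
proof -
  have "1 - q * q ^ r \<noteq> 0" for r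
    using assms unfolding generic_def by (metis One_nat_def Suc_le_mono le0 power_Suc right_minus_eq)
  then show "q_pochhammer q q n \<noteq> 0" by (simp add: q_pochhammer_def)
  have "1 - s\<^sup>2 * q ^ r \<noteq> 0" for r
    using assms unfolding generic_def by (metis right_minus_eq)
  then show "q_pochhammer (s\<^sup>2) q n \<noteq> 0" by (simp add: q_pochhammer_def)
qed

text \<open>When a path turns, the quotient of Pochhammer symbols reduces to one factor
  \<open>(1 - s^2 q^m) / (1 - q^(m+1))\<close> or its inverse, so conjugation just swaps the
  numerators of the two turning vertices.\<close>

lemma conj_weight_eq:
  assumes "generic q s"
  shows "conj_weight q s u i1 j1 i2 j2 =
    (if j1 = 0 \<and> j2 = 0 \<and> i1 = i2 then (1 - s * q ^ i1 * u) / (1 - s * u)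
     else if j1 = 1 \<and> j2 = 1 \<and> i1 = i2 then (u - s * q ^ i1) / (1 - s * u)
     else if j1 = 0 \<and> j2 = 1 \<and> i1 = i2 + 1 then (1 - q ^ (i2 + 1)) * u / (1 - s * u)
     else if j1 = 1 \<and> j2 = 0 \<and> i2 = i1 + 1 then (1 - s\<^sup>2 * q ^ i1) / (1 - s * u)
     else 0)"
proof -
  have nz: "1 - q * q ^ n \<noteq> 0" "1 - s\<^sup>2 * q ^ n \<noteq> 0" for n
    using q_pochhammer_nonzero[OF assms, of "Suc n"] by (auto simp: q_pochhammer_Suc)
  show ?thesis
    using q_pochhammer_nonzero[OF assms] nz
    by (auto simp: conj_weight_def vertex_weight_def q_pochhammer_Suc simp del: power_Suc)
       (auto simp: divide_simps)
qed

text \<open>A column of two rows, with parameters \<open>u\<close> and \<open>v\<close>, which share their upper state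
  (\<open>column_above\<close>) or their lower state (\<open>column_below\<close>); the remaining multiplicity is \<open>l\<close> in the
  \<open>u\<close>-row and \<open>m\<close> in the \<open>v\<close>-row for the former, and the other way round for the latter.  In both rows \<open>r, r'\<close> paths come in from the left and \<open>p, p'\<close> leave to the right.\<close>

definition column_above ::
  "complex \<Rightarrow> complex \<Rightarrow> complex \<Rightarrow> complex \<Rightarrow> nat \<Rightarrow> nat \<Rightarrow> nat \<Rightarrow> nat \<Rightarrow> nat \<Rightarrow> nat \<Rightarrow> complex" where
  "column_above q s u v l m r r' p p' =
     (if p \<le> l + r then vertex_weight q s u l r (l + r - p) p * conj_weight q s v m r' (l + r - p) p'
      else 0)"

definition column_below ::
  "complex \<Rightarrow> complex \<Rightarrow> complex \<Rightarrow> complex \<Rightarrow> nat \<Rightarrow> nat \<Rightarrow> nat \<Rightarrow> nat \<Rightarrow> nat \<Rightarrow> nat \<Rightarrow> complex" where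
  "column_below q s u v l m r r' p p' =
     (if r' \<le> l + p' then conj_weight q s v (l + p' - r') r' l p' * vertex_weight q s u (l + p' - r') r m p
      else 0)"

text \<open>The six-vertex R-matrix, multiplied by $1 - quv$ so that the case $quv = 1$ needs no exclusion.\<close>

definition cross :: "complex \<Rightarrow> complex \<Rightarrow> complex \<Rightarrow> nat \<Rightarrow> nat \<Rightarrow> nat \<Rightarrow> nat \<Rightarrow> complex" where
  "cross q u v p p' r r' =
    (if p = 0 \<and> p' = 0 \<and> r = 0 \<and> r' = 0 then 1 - u * v
     else if p = 0 \<and> p' = 0 \<and> r = 1 \<and> r' = 1 then 1 - q
     else if p = 1 \<and> p' = 1 \<and> r = 0 \<and> r' = 0 then u * v * (1 - q)
     else if p = 1 \<and> p' = 1 \<and> r = 1 \<and> r' = 1 then q * (1 - u * v)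
     else if p + p' = 1 \<and> r = p \<and> r' = p' then 1 - q * u * v else 0)"

text \<open>Moving the R-matrix from the left of a column to its right turns a shared lower state
  into a shared upper one. Conservation fixes the shared multiplicity, so for each difference of
  \<open>l\<close> and \<open>m\<close> this is a finite list of identities in \<open>q\<close>,
  \<open>q^l\<close>, \<open>s\<close>, \<open>u\<close> and \<open>v\<close>.\<close>

lemma yang_baxter_column:
  assumes "generic q s" "p < 2" "p' < 2" "t < 2" "t' < 2"
  shows "(\<Sum>r<2. \<Sum>r'<2. cross q u v r r' t t' * column_below q s u v l m r r' p p') =
         (\<Sum>r<2. \<Sum>r'<2. column_above q s u v l m t t' r r' * cross q u v p p' r r')"
proof -
  \<comment> \<open>Every term on either side carries exactly one factor \<open>i\<close> and one
    factor \<open>j\<close>; as opaque symbols they leave a polynomial identity.\<close>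
  define i where "i = inverse (1 - s * u)"
  define j where "j = inverse (1 - s * v)"
  have p: "p = 0 \<or> p = 1" "p' = 0 \<or> p' = 1" "t = 0 \<or> t = 1" "t' = 0 \<or> t' = 1"
    using assms by auto
  \<comment> \<open>Each horizontal edge changes the difference of \<open>l\<close> and
    \<open>m\<close> by at most one, and there are four of them in two opposing pairs. Beyond a
    difference of 2 both sides vanish.\<close>
  have lm: "m = l \<or> m = Suc l \<or> m = Suc (Suc l) \<or> l = Suc m \<or> l = Suc (Suc m) \<or> m > l + 2 \<or> l > m + 2"
    by auto
  have l0: "l = 0 \<or> (\<exists>k. l = Suc k)" by (cases l) auto
  note d = column_below_def column_above_def conj_weight_eq[OF assms(1)] vertex_weight_def cross_def
    numeral_2_eq_2 divide_inverse i_def[symmetric] j_def[symmetric]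
  show ?thesis
    using p lm
    apply (elim disjE)
    apply (simp_all add: d)
    using l0
    apply (auto simp: d power2_eq_square)
    apply (simp_all add: algebra_simps)
    done
qed

lemma vertex_weight_conserves:
  assumes "vertex_weight q s u i1 j1 i2 j2 \<noteq> 0"
  shows "i1 + j1 = i2 + j2" "j1 < 2" "j2 < 2"
  using assms by (auto simp: vertex_weight_def split: if_splits)

lemma conj_weight_conserves:
  assumes "conj_weight q s u i1 j1 i2 j2 \<noteq> 0"
  shows "i1 + j1 = i2 + j2" "j1 < 2" "j2 < 2"
proof -
  have "vertex_weight q s u i1 j1 i2 j2 \<noteq> 0" using assms by (auto simp: conj_weight_def)
  then show "i1 + j1 = i2 + j2" "j1 < 2" "j2 < 2" by (fact vertex_weight_conserves)+
qed

section \<open>Sums over states supported in the first n columns\<close>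

definition column_sum :: "(nat \<Rightarrow> nat \<Rightarrow> nat \<Rightarrow> complex) \<Rightarrow> nat \<Rightarrow> nat \<Rightarrow> complex" where
  "column_sum f n k = (\<Sum>A | set_mset A \<subseteq> {..<n} \<and> size A = k. \<Prod>x<n. f x (count A x) (lt_count A x))"

lemma finite_multisets_of_size: "finite {A :: nat multiset. set_mset A \<subseteq> {..<n} \<and> size A = k}"
  by (rule finite_subset[OF _ finite_bounded_multisets[of n k]]) auto

lemma column_sum_0: "column_sum f 0 k = (if k = 0 then 1 else 0)"
proof -
  have "{A :: nat multiset. A = {#} \<and> size A = k} = (if k = 0 then {{#}} else {})" by auto
  then show ?thesis by (simp add: column_sum_def)
qed

lemma lt_count_cong:
  assumes "\<And>y. y < x \<Longrightarrow> count A y = count B y"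
  shows "lt_count A x = lt_count B x"
  using assms by (induction x) (auto simp: lt_count_Suc)

text \<open>The local factor sees the state only through its multiplicity at the column and the
  number of entries further left. The copies of \<open>n\<close> can therefore be split off:
  \<open>j\<close> entries remain in the earlier columns and \<open>k - j\<close> copies are
  removed.\<close>

lemma column_sum_Suc:
  "column_sum f (Suc n) k = (\<Sum>j\<le>k. column_sum f n j * f n (k - j) j)"
proof -
  let ?M = "\<lambda>n k. {A :: nat multiset. set_mset A \<subseteq> {..<n} \<and> size A = k}"
  let ?g = "\<lambda>n A. \<Prod>x<n. f x (count A x) (lt_count A x)"
  have "(\<Sum>j\<le>k. column_sum f n j * f n (k - j) j) =
     (\<Sum>(j, A)\<in>Sigma {..k} (?M n). ?g n A * f n (k - j) j)"
    unfolding column_sum_def sum_distrib_right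
    by (subst sum.Sigma) (auto simp: finite_multisets_of_size)
  also have "\<dots> = (\<Sum>A\<in>?M (Suc n) k. ?g (Suc n) A)"
  proof (rule sum.reindex_bij_witness[where
        i = "\<lambda>A. (lt_count A n, {#x \<in># A. x < n#})" and
        j = "\<lambda>(j, A). A + replicate_mset (k - j) n"])
    fix a assume a: "a \<in> Sigma {..k} (?M n)"
    then obtain j A where jA: "a = (j, A)" "j \<le> k" "set_mset A \<subseteq> {..<n}" "size A = j" by auto
    have A: "{#x \<in># A. x < n#} = A" using jA by (auto simp: filter_mset_eq_conv)
    have lt: "lt_count (A + replicate_mset (k - j) n) n = j"
      using A jA by (simp add: lt_count_def)
    show "(lt_count (case a of (j, A) \<Rightarrow> A + replicate_mset (k - j) n) n,
          {#x \<in># case a of (j, A) \<Rightarrow> A + replicate_mset (k - j) n. x < n#}) = a"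
      using lt A jA by simp
    show "(case a of (j, A) \<Rightarrow> A + replicate_mset (k - j) n) \<in> ?M (Suc n) k"
      using jA by (auto split: if_splits)
    have c: "count A n = 0" using jA by (auto simp: count_eq_zero_iff)
    have "?g n (A + replicate_mset (k - j) n) = ?g n A"
    proof (rule prod.cong)
      fix x assume x: "x \<in> {..<n}"
      then have "lt_count (A + replicate_mset (k - j) n) x = lt_count A x"
        by (intro lt_count_cong) auto
      with x show "f x (count (A + replicate_mset (k - j) n) x) (lt_count (A + replicate_mset (k - j) n) x)
          = f x (count A x) (lt_count A x)" by simp
    qed simp
    then show "?g (Suc n) (case a of (j, A) \<Rightarrow> A + replicate_mset (k - j) n) =
      (case a of (j, A) \<Rightarrow> ?g n A * f n (k - j) j)"
      using jA lt c by simp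
  next
    fix A assume A: "A \<in> ?M (Suc n) k"
    have lt: "lt_count A n + count A n = k"
      using A lt_count_eq_size_iff[of A "Suc n"] by (simp add: lt_count_Suc)
    show "(case (lt_count A n, {#x \<in># A. x < n#}) of (j, A) \<Rightarrow> A + replicate_mset (k - j) n) = A"
    proof -
      have "count A x = 0" if "x > n" for x
        using A that by (auto simp: count_eq_zero_iff)
      moreover have "k - lt_count A n = count A n" using lt by simp
      ultimately show ?thesis by (auto intro!: multiset_eqI)
    qed
    show "(lt_count A n, {#x \<in># A. x < n#}) \<in> Sigma {..k} (?M n)"
      using lt by (auto simp: lt_count_def)
  qed
  finally show ?thesis by (simp add: column_sum_def)
qed

text \<open>Conservation at a vertex of nonzero weight shows that the outgoing truncated difference
  is a true one. Thus if nothing was truncated up to a column, nothing is truncated in it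
  either.\<close>

lemma flux_step:
  fixes l k j a :: nat
  assumes "l + (a - j) = k - j + (a + l - k)" "a + l - k < 2" "j \<le> a" "j \<le> k"
  shows "k \<le> a + l \<and> a + l \<le> k + 1"
proof -
  have "l + a = k + (a + l - k)" using assms by simp
  then show ?thesis using assms(2) by simp
qed

lemma flux_step':
  fixes l k j a b :: nat
  assumes "k - j + (b + j - a) = l + (b + k - (a + l))" "b + k - (a + l) < 2" "a \<le> b + j" "j \<le> k"
  shows "a + l \<le> b + k \<and> b + k \<le> a + l + 1"
proof -
  have "b + k = (a + l) + (b + k - (a + l))" using assms by simp
  then show ?thesis using assms(2) by simp
qed

lemma sum_atMost_two:
  fixes g :: "nat \<Rightarrow> complex"
  assumes "\<And>j. j \<noteq> a \<Longrightarrow> j \<noteq> Suc a \<Longrightarrow> g j = 0"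
  shows "(\<Sum>j\<le>k. g j) = (if a \<le> k then g a else 0) + (if Suc a \<le> k then g (Suc a) else 0)"
proof -
  have "(\<Sum>j\<le>k. g j) = (\<Sum>j\<in>{a, Suc a} \<inter> {..k}. g j)"
    by (rule sum.mono_neutral_right) (use assms in auto)
  also have "{a, Suc a} \<inter> {..k} = (if a \<le> k then {a} else {}) \<union> (if Suc a \<le> k then {Suc a} else {})"
    by auto
  finally show ?thesis by (auto simp: sum.insert_if)
qed

context
  fixes q s u v :: complex and lam mu :: "nat multiset"
begin

text \<open>\<open>j\<close> is the multiplicity of the shared upper state at column
  \<open>x\<close>, and \<open>k\<close> the number of its entries further left. The summand 1 is
  the path that enters the \<open>u\<close>-row at the far left; the \<open>v\<close>-row receives
  none.\<close>

definition above_term :: "nat \<Rightarrow> nat \<Rightarrow> nat \<Rightarrow> complex" where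
  "above_term x j k = vertex_weight q s u (count lam x) (1 + lt_count lam x - k) j (1 + lt_count lam (Suc x) - (k + j)) *
     conj_weight q s v (count mu x) (lt_count mu x - k) j (lt_count mu (Suc x) - (k + j))"

definition below_term :: "nat \<Rightarrow> nat \<Rightarrow> nat \<Rightarrow> complex" where
  "below_term x j k = conj_weight q s v j (k - lt_count lam x) (count lam x) (k + j - lt_count lam (Suc x)) *
     vertex_weight q s u j (1 + k - lt_count mu x) (count mu x) (1 + (k + j) - lt_count mu (Suc x))"

text \<open>A horizontal edge carries at most one path, so \<open>k\<close> is known up to one from
  either row. This makes the truncated differences exact and leaves only two terms in the recursion
  for \<open>column_sum\<close>.\<close>

lemma above_support:
  assumes "column_sum above_term n k \<noteq> 0"
  shows "k \<le> 1 + lt_count lam n" "1 + lt_count lam n \<le> k + 1" "k \<le> lt_count mu n" "lt_count mu n \<le> k + 1"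
proof -
  have "k \<le> 1 + lt_count lam n \<and> 1 + lt_count lam n \<le> k + 1 \<and> k \<le> lt_count mu n \<and> lt_count mu n \<le> k + 1"
    using assms
  proof (induction n arbitrary: k)
    case 0
    then show ?case by (auto simp: column_sum_0 split: if_splits)
  next
    case (Suc n)
    then obtain j where j: "j \<le> k" "column_sum above_term n j \<noteq> 0" "above_term n (k - j) j \<noteq> 0"
      unfolding column_sum_Suc by (elim sum.not_neutral_contains_not_neutral) auto
    from j(3) have nz: "vertex_weight q s u (count lam n) (1 + lt_count lam n - j) (k - j) (1 + lt_count lam n + count lam n - k) \<noteq> 0"
      "conj_weight q s v (count mu n) (lt_count mu n - j) (k - j) (lt_count mu n + count mu n - k) \<noteq> 0"
      using j(1) unfolding above_term_def lt_count_Suc by auto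
    show ?case
      using flux_step[OF vertex_weight_conserves(1,3)[OF nz(1)]]
        flux_step[OF conj_weight_conserves(1,3)[OF nz(2)]] Suc.IH[OF j(2)] j(1)
      by (simp add: lt_count_Suc)
  qed
  then show "k \<le> 1 + lt_count lam n" "1 + lt_count lam n \<le> k + 1" "k \<le> lt_count mu n" "lt_count mu n \<le> k + 1"
    by auto
qed

lemma below_support:
  assumes "column_sum below_term n k \<noteq> 0"
  shows "lt_count lam n \<le> k" "k \<le> lt_count lam n + 1" "lt_count mu n \<le> k + 1" "k \<le> lt_count mu n"
proof -
  have "lt_count lam n \<le> k \<and> k \<le> lt_count lam n + 1 \<and> lt_count mu n \<le> k + 1 \<and> k \<le> lt_count mu n"
    using assms
  proof (induction n arbitrary: k)
    case 0
    then show ?case by (auto simp: column_sum_0 split: if_splits)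
  next
    case (Suc n)
    then obtain j where j: "j \<le> k" "column_sum below_term n j \<noteq> 0" "below_term n (k - j) j \<noteq> 0"
      unfolding column_sum_Suc by (elim sum.not_neutral_contains_not_neutral) auto
    from j(3) have nz: "conj_weight q s v (k - j) (0 + j - lt_count lam n) (count lam n) (0 + k - (lt_count lam n + count lam n)) \<noteq> 0"
      "vertex_weight q s u (k - j) (1 + j - lt_count mu n) (count mu n) (1 + k - (lt_count mu n + count mu n)) \<noteq> 0"
      using j(1) unfolding below_term_def lt_count_Suc by auto
    show ?case
      using flux_step'[OF conj_weight_conserves(1,3)[OF nz(1)]]
        flux_step'[OF vertex_weight_conserves(1,3)[OF nz(2)]] Suc.IH[OF j(2)] j(1)
      by (simp add: lt_count_Suc)
  qed
  then show "lt_count lam n \<le> k" "k \<le> lt_count lam n + 1" "lt_count mu n \<le> k + 1" "k \<le> lt_count mu n"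
    by auto
qed

text \<open>Here \<open>p\<close> and \<open>p'\<close> are the numbers of paths leaving the first \<open>n\<close> columns to the right in the
  row with parameter \<open>u\<close> and in the row with parameter \<open>v\<close>.\<close>

definition sum_above :: "nat \<Rightarrow> nat \<Rightarrow> nat \<Rightarrow> complex" where
  "sum_above n p p' = (if p \<le> 1 + lt_count lam n \<and> lt_count mu n + p = 1 + lt_count lam n + p'
     then column_sum above_term n (1 + lt_count lam n - p) else 0)"

definition sum_below :: "nat \<Rightarrow> nat \<Rightarrow> nat \<Rightarrow> complex" where
  "sum_below n p p' = (if lt_count lam n + p' + 1 = lt_count mu n + p
     then column_sum below_term n (lt_count lam n + p') else 0)"

lemma sum_above_0: "p < 2 \<Longrightarrow> sum_above 0 p p' = (if p = 1 \<and> p' = 0 then 1 else 0)"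
  by (auto simp: sum_above_def column_sum_0)

lemma sum_below_0: "p < 2 \<Longrightarrow> sum_below 0 p p' = (if p = 1 \<and> p' = 0 then 1 else 0)"
  by (auto simp: sum_below_def column_sum_0)

text \<open>The recursion for \<open>column_sum\<close> runs over the number \<open>j\<close> of
  entries in the first \<open>n\<close> columns. As \<open>j = 1 + lt_count lam n - r\<close>, this
  is a sum over the \<open>u\<close>-edge \<open>r\<close> entering column \<open>n\<close>; the
  \<open>v\<close>-edge \<open>r'\<close> is then forced by conservation.\<close>

lemma sum_above_Suc:
  assumes "p < 2" "p' < 2"
  shows "sum_above (Suc n) p p' = (\<Sum>r<2. \<Sum>r'<2. sum_above n r r' *
     column_above q s u v (count lam n) (count mu n) r r' p p')"
proof (cases "p \<le> 1 + lt_count lam (Suc n) \<and> lt_count mu (Suc n) + p = 1 + lt_count lam (Suc n) + p'")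
  case True
  define a where "a = lt_count lam n"
  define c where "c = lt_count mu n"
  define l where "l = count lam n"
  define m where "m = count mu n"
  define k where "k = 1 + a + l - p"
  have z: "column_sum above_term n j = 0" if "j \<noteq> a \<and> j \<noteq> Suc a \<or> j > c \<or> c > Suc j" for j
  proof (rule ccontr)
    assume "column_sum above_term n j \<noteq> 0"
    from above_support[OF this] that show False unfolding a_def c_def by linarith
  qed
  have "sum_above (Suc n) p p' = column_sum above_term (Suc n) k"
    using True by (simp add: sum_above_def k_def a_def l_def lt_count_Suc)
  also have "\<dots> = (if a \<le> k then column_sum above_term n a * above_term n (k - a) a else 0) +
      (if Suc a \<le> k then column_sum above_term n (Suc a) * above_term n (k - Suc a) (Suc a) else 0)"
    unfolding column_sum_Suc by (rule sum_atMost_two) (use z in auto)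
  also have "\<dots> = (\<Sum>r<2. \<Sum>r'<2. sum_above n r r' * column_above q s u v l m r r' p p')"
  proof -
    have t: "p \<le> 1 + (a + l)" "c + m + p = 1 + (a + l) + p'"
      using True by (simp_all add: lt_count_Suc a_def l_def c_def m_def)
    have ab: "above_term n (k - j) j = vertex_weight q s u l (Suc a - j) (k - j) p * conj_weight q s v m (c - j) (k - j) p'" if "j \<le> k" for j
    proof -
      have "j + (k - j) = k" using that by simp
      moreover have "Suc (a + l) - k = p" "c + m - k = p'" using t by (auto simp: k_def)
      ultimately show ?thesis
        by (simp add: above_term_def lt_count_Suc a_def c_def l_def m_def)
    qed
    have above0: "sum_above n 0 r' = (if c = Suc a + r' then column_sum above_term n (Suc a) else 0)" for r'
      by (simp add: sum_above_def a_def c_def)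
    have above1: "sum_above n 1 r' = (if c = a + r' then column_sum above_term n a else 0)" for r'
      by (simp add: sum_above_def a_def c_def)
    have sum2: "(\<Sum>r<2. f r) = f 0 + f (1::nat)" for f :: "nat \<Rightarrow> complex"
      by (simp add: numeral_2_eq_2)
    have 0: "(if Suc a \<le> k then column_sum above_term n (Suc a) * above_term n (k - Suc a) (Suc a) else 0)
      = (\<Sum>r'<2. sum_above n 0 r' * column_above q s u v l m 0 r' p p')"
    proof (cases "c = Suc a \<or> c = Suc (Suc a)")
      case True
      have "Suc a \<le> k \<longleftrightarrow> p \<le> l" using t(1) by (auto simp: k_def)
      moreover have "k - Suc a = l - p" by (simp add: k_def)
      ultimately show ?thesis using ab[of "Suc a"] True unfolding sum2 above0 column_above_def
        by (elim disjE) simp_all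
    next
      case False
      then have "c < Suc a \<or> Suc (Suc a) < c" by linarith
      then show ?thesis using z[of "Suc a"] unfolding sum2 above0 by simp
    qed
    have 1: "(if a \<le> k then column_sum above_term n a * above_term n (k - a) a else 0)
      = (\<Sum>r'<2. sum_above n 1 r' * column_above q s u v l m 1 r' p p')"
    proof (cases "c = a \<or> c = Suc a")
      case True
      have "a \<le> k \<longleftrightarrow> p \<le> l + 1" using t(1) by (auto simp: k_def)
      moreover have "k - a = l + 1 - p" by (simp add: k_def)
      ultimately show ?thesis using ab[of a] True unfolding sum2 above1 column_above_def
        by (elim disjE) simp_all
    next
      case False
      then have "c < a \<or> Suc a < c" by linarith
      then show ?thesis using z[of a] unfolding sum2 above1 by simp
    qed
    show ?thesis unfolding 0 1 using sum2[of "\<lambda>r. \<Sum>r'<2. sum_above n r r' * column_above q s u v l m r r' p p'"]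
      by simp
  qed
  finally show ?thesis by (simp add: l_def m_def)
next
  case False
  \<comment> \<open>If the outgoing edges do not balance, conservation in column \<open>n\<close>
    passes the imbalance on to the earlier columns, so every summand vanishes.\<close>
  have zero: "sum_above n r r' * column_above q s u v (count lam n) (count mu n) r r' p p' = 0" for r r'
  proof (rule ccontr)
    assume "\<not> ?thesis"
    then have nz: "sum_above n r r' \<noteq> 0" "column_above q s u v (count lam n) (count mu n) r r' p p' \<noteq> 0"
      by simp_all
    have "r \<le> 1 + lt_count lam n" "lt_count mu n + r = 1 + lt_count lam n + r'"
      using nz(1) by (auto simp: sum_above_def split: if_splits)
    moreover have "p \<le> count lam n + r" "count mu n + r' = count lam n + r - p + p'"
      using nz(2) conj_weight_conserves(1)[of q s v "count mu n" r' "count lam n + r - p" p']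
      by (auto simp: column_above_def split: if_splits)
    ultimately show False using False unfolding lt_count_Suc by linarith
  qed
  have "(\<Sum>r<2. \<Sum>r'<2. sum_above n r r' *
     column_above q s u v (count lam n) (count mu n) r r' p p') = 0"
    by (intro sum.neutral ballI zero)
  moreover have "sum_above (Suc n) p p' = 0" using False by (auto simp: sum_above_def)
  ultimately show ?thesis by simp
qed

text \<open>The shared state is now the lower one, and \<open>j = lt_count lam n + r'\<close>, so it
  is the edge of the \<open>v\<close>-row that indexes the two surviving terms.\<close>

lemma sum_below_Suc:
  assumes "p < 2" "p' < 2"
  shows "sum_below (Suc n) p p' = (\<Sum>r'<2. \<Sum>r<2. sum_below n r r' *
     column_below q s u v (count lam n) (count mu n) r r' p p')"
proof (cases "lt_count lam (Suc n) + p' + 1 = lt_count mu (Suc n) + p")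
  case True
  define a where "a = lt_count lam n"
  define c where "c = lt_count mu n"
  define l where "l = count lam n"
  define m where "m = count mu n"
  define k where "k = a + l + p'"
  have z: "column_sum below_term n j = 0" if "j \<noteq> a \<and> j \<noteq> Suc a \<or> c > Suc j \<or> j > c" for j
  proof (rule ccontr)
    assume "column_sum below_term n j \<noteq> 0"
    from below_support[OF this] that show False unfolding a_def c_def by linarith
  qed
  have "sum_below (Suc n) p p' = column_sum below_term (Suc n) k"
    using True by (simp add: sum_below_def k_def a_def l_def lt_count_Suc)
  also have "\<dots> = (if a \<le> k then column_sum below_term n a * below_term n (k - a) a else 0) +
      (if Suc a \<le> k then column_sum below_term n (Suc a) * below_term n (k - Suc a) (Suc a) else 0)"
    unfolding column_sum_Suc by (rule sum_atMost_two) (use z in auto)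
  also have "\<dots> = (\<Sum>r'<2. \<Sum>r<2. sum_below n r r' * column_below q s u v l m r r' p p')"
  proof -
    have t: "a + l + p' + 1 = c + m + p"
      using True by (simp add: lt_count_Suc a_def l_def c_def m_def)
    have bt: "below_term n (k - j) j =
        conj_weight q s v (k - j) (j - a) l p' * vertex_weight q s u (k - j) (1 + j - c) m p" if "j \<le> k" for j
    proof -
      have "j + (k - j) = k" using that by simp
      moreover have "k - (a + l) = p'" "Suc k - (c + m) = p" using t by (auto simp: k_def)
      ultimately show ?thesis
        by (simp add: below_term_def lt_count_Suc a_def c_def l_def m_def)
    qed
    have sum2: "(\<Sum>r<2. f r) = f 0 + f (1::nat)" for f :: "nat \<Rightarrow> complex"
      by (simp add: numeral_2_eq_2)
    have below0: "sum_below n r 0 = (if Suc a = c + r then column_sum below_term n a else 0)" for r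
      by (simp add: sum_below_def a_def c_def)
    have below1: "sum_below n r 1 = (if Suc (Suc a) = c + r then column_sum below_term n (Suc a) else 0)" for r
      by (simp add: sum_below_def a_def c_def)
    have 0: "(if a \<le> k then column_sum below_term n a * below_term n (k - a) a else 0)
      = (\<Sum>r<2. sum_below n r 0 * column_below q s u v l m r 0 p p')"
    proof (cases "c = a \<or> c = Suc a")
      case True
      have "a \<le> k" "k - a = l + p'" by (auto simp: k_def)
      then show ?thesis using bt[of a] True unfolding sum2 below0 column_below_def
        by (elim disjE) simp_all
    next
      case False
      then have "c > Suc a \<or> a > c" by linarith
      then show ?thesis using z[of a] unfolding sum2 below0 by auto
    qed
    have 1: "(if Suc a \<le> k then column_sum below_term n (Suc a) * below_term n (k - Suc a) (Suc a) else 0)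
      = (\<Sum>r<2. sum_below n r 1 * column_below q s u v l m r 1 p p')"
    proof (cases "c = Suc a \<or> c = Suc (Suc a)")
      case True
      have "Suc a \<le> k \<longleftrightarrow> 1 \<le> l + p'" "k - Suc a = l + p' - 1" by (auto simp: k_def)
      then show ?thesis using bt[of "Suc a"] True unfolding sum2 below1 column_below_def
        by (elim disjE) simp_all
    next
      case False
      then have "c > Suc (Suc a) \<or> Suc a > c" by linarith
      then show ?thesis using z[of "Suc a"] unfolding sum2 below1 by auto
    qed
    show ?thesis unfolding 0 1
      using sum2[of "\<lambda>r'. \<Sum>r<2. sum_below n r r' * column_below q s u v l m r r' p p'"]
      by simp
  qed
  finally show ?thesis by (simp add: l_def m_def)
next
  case False
  have zero: "sum_below n r r' * column_below q s u v (count lam n) (count mu n) r r' p p' = 0" for r r'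
  proof (rule ccontr)
    assume "\<not> ?thesis"
    then have nz: "sum_below n r r' \<noteq> 0" "column_below q s u v (count lam n) (count mu n) r r' p p' \<noteq> 0"
      by simp_all
    have "lt_count lam n + r' + 1 = lt_count mu n + r"
      using nz(1) by (auto simp: sum_below_def split: if_splits)
    moreover have "r' \<le> count lam n + p'" "count lam n + p' - r' + r = count mu n + p"
      using nz(2) vertex_weight_conserves(1)[of q s u "count lam n + p' - r'" r "count mu n" p]
      by (auto simp: column_below_def split: if_splits)
    ultimately show False using False unfolding lt_count_Suc by linarith
  qed
  have "(\<Sum>r'<2. \<Sum>r<2. sum_below n r r' *
     column_below q s u v (count lam n) (count mu n) r r' p p') = 0"
    by (intro sum.neutral ballI zero)
  moreover have "sum_below (Suc n) p p' = 0" using False by (auto simp: sum_below_def)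
  ultimately show ?thesis by simp
qed

text \<open>The column relation carries the R-matrix from the left boundary to the right one. At the
  left boundary one path enters the \<open>u\<close>-row and none the \<open>v\<close>-row; there
  the R-matrix acts as the scalar \<open>1 - q * u * v\<close>, the factor on the left-hand
  side.\<close>

lemma sum_below_eq_cross_above:
  assumes "generic q s" "p < 2" "p' < 2"
  shows "(1 - q * u * v) * sum_below n p p' = (\<Sum>r<2. \<Sum>r'<2. sum_above n r r' * cross q u v p p' r r')"
  using assms(2,3)
proof (induction n arbitrary: p p')
  case 0
  have p: "p = 0 \<or> p = 1" "p' = 0 \<or> p' = 1" using 0 by auto
  then show ?case using 0 by (auto simp: sum_above_0 sum_below_0 cross_def numeral_2_eq_2)
next
  case (Suc n)
  let ?A = "\<lambda>t t' r r'. column_above q s u v (count lam n) (count mu n) t t' r r'"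
  let ?B = "\<lambda>r r'. column_below q s u v (count lam n) (count mu n) r r' p p'"
  have "(1 - q * u * v) * sum_below (Suc n) p p' =
      (\<Sum>r'<2. \<Sum>r<2. ((1 - q * u * v) * sum_below n r r') * ?B r r')"
    unfolding sum_below_Suc[OF Suc.prems] by (simp add: sum_distrib_left mult.assoc)
  also have "\<dots> = (\<Sum>r'<2. \<Sum>r<2. (\<Sum>t<2. \<Sum>t'<2. sum_above n t t' * cross q u v r r' t t') * ?B r r')"
    by (intro sum.cong refl arg_cong2[where f = times]) (simp add: Suc.IH)
  also have "\<dots> = (\<Sum>t<2. \<Sum>t'<2. sum_above n t t' * (\<Sum>r<2. \<Sum>r'<2. cross q u v r r' t t' * ?B r r'))"
    by (simp add: numeral_2_eq_2 algebra_simps)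
  also have "\<dots> = (\<Sum>t<2. \<Sum>t'<2. sum_above n t t' * (\<Sum>r<2. \<Sum>r'<2. ?A t t' r r' * cross q u v p p' r r'))"
    by (intro sum.cong refl arg_cong2[where f = times] yang_baxter_column) (use assms(1) Suc.prems in auto)
  also have "\<dots> = (\<Sum>r<2. \<Sum>r'<2. (\<Sum>t<2. \<Sum>t'<2. sum_above n t t' * ?A t t' r r') * cross q u v p p' r r')"
    by (simp add: numeral_2_eq_2 algebra_simps)
  also have "\<dots> = (\<Sum>r<2. \<Sum>r'<2. sum_above (Suc n) r r' * cross q u v p p' r r')"
    by (intro sum.cong refl arg_cong2[where f = times]) (simp add: sum_above_Suc)
  finally show ?case .
qed

end

section \<open>One row of each kind: passage to infinitely many columns\<close>

lemma row_eq_prod: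
  assumes W: "\<And>i1 j1 i2 j2. W i1 j1 i2 j2 \<noteq> 0 \<Longrightarrow> i1 + j1 = i2 + j2" "W 0 0 0 0 = 1"
    and "size B = size A + b" "set_mset A \<subseteq> {..<n}" "set_mset B \<subseteq> {..<n}"
  shows "row_weight W b A B = (\<Prod>x<n. W (count A x) (flux b A B x) (count B x) (flux b A B (Suc x)))"
proof (cases "admissible b A B")
  case True
  then show ?thesis using row_eq assms by blast
next
  case False
  \<comment> \<open>Truncated fluxes are meaningless for a pair that is not admissible, but the
    product still vanishes: if all factors were nonzero, conservation carried from left to right
    would give every inequality. Hence column sums may run over all multisets of the right
    size.\<close>
  have "\<exists>x<n. W (count A x) (flux b A B x) (count B x) (flux b A B (Suc x)) = 0"
  proof (rule ccontr)
    assume "\<not> ?thesis"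
    then have nz: "W (count A x) (flux b A B x) (count B x) (flux b A B (Suc x)) \<noteq> 0" if "x < n" for x
      using that by auto
    have *: "lt_count B x \<le> b + lt_count A x" if "x \<le> n" for x
      using that
    proof (induction x)
      case (Suc x)
      then have "count A x + flux b A B x = count B x + flux b A B (Suc x)" "lt_count B x \<le> b + lt_count A x"
        using W(1)[OF nz[of x]] by auto
      then have "b + lt_count A x + count A x = lt_count B x + count B x + flux b A B (Suc x)"
        by (simp add: flux_def[of b A B x])
      then show ?case by (simp add: lt_count_Suc)
    qed simp
    have "lt_count B x \<le> b + lt_count A x" for x
    proof (cases "x \<le> n")
      case False
      then have "set_mset A \<subseteq> {..<x}" using assms by auto
      then have "lt_count A x = size A" by (simp add: lt_count_eq_size_iff)
      then show ?thesis using lt_count_le_size[of B x] assms by simp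
    qed (rule *)
    then show False using False assms by (simp add: admissible_def)
  qed
  then have "(\<Prod>x<n. W (count A x) (flux b A B x) (count B x) (flux b A B (Suc x))) = 0"
    by auto
  then show ?thesis using False by (simp add: row_weight_def)
qed

lemma row_size: "row_weight W b A B \<noteq> 0 \<Longrightarrow> size B = size A + b"
  by (auto simp: row_weight_def admissible_def split: if_splits)

lemma vertex_weight_empty: "1 - s * u \<noteq> 0 \<Longrightarrow> vertex_weight q s u 0 0 0 0 = 1"
  by (simp add: vertex_weight_def)

lemma conj_weight_empty: "1 - s * u \<noteq> 0 \<Longrightarrow> conj_weight q s u 0 0 0 0 = 1"
  by (simp add: conj_weight_def vertex_weight_def q_pochhammer_def)

text \<open>Turns sums over the first \<open>n\<close> columns into partial sums along the filter of
  finite subsets, so an infinite sum can be computed as a sequential limit.\<close>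

lemma filterlim_bounded_multisets:
  "filterlim (\<lambda>n. {A :: nat multiset. set_mset A \<subseteq> {..<n} \<and> size A = k})
    (finite_subsets_at_top {A. size A = k}) sequentially"
  unfolding filterlim_finite_subsets_at_top
proof (intro allI impI)
  fix X :: "nat multiset set" assume X: "finite X \<and> X \<subseteq> {A. size A = k}"
  show "\<forall>\<^sub>F n in sequentially. finite {A :: nat multiset. set_mset A \<subseteq> {..<n} \<and> size A = k} \<and>
      X \<subseteq> {A. set_mset A \<subseteq> {..<n} \<and> size A = k} \<and>
      {A. set_mset A \<subseteq> {..<n} \<and> size A = k} \<subseteq> {A. size A = k}"
    unfolding eventually_sequentially
  proof (intro exI allI impI)
    fix n assume n: "n \<ge> (\<Sum>A\<in>X. Suc (sum_mset A))"
    have "set_mset A \<subseteq> {..<n}" if "A \<in> X" for A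
    proof -
      have "Suc (sum_mset A) \<le> (\<Sum>A\<in>X. Suc (sum_mset A))"
        using X that by (intro member_le_sum) auto
      then show ?thesis using n subset_sum_mset[of A] by (meson lessThan_subset_iff order_trans)
    qed
    then show "finite {A :: nat multiset. set_mset A \<subseteq> {..<n} \<and> size A = k} \<and>
      X \<subseteq> {A. set_mset A \<subseteq> {..<n} \<and> size A = k} \<and>
      {A. set_mset A \<subseteq> {..<n} \<and> size A = k} \<subseteq> {A. size A = k}"
      using X finite_multisets_of_size by auto
  qed
qed

lemma skew_cauchy_one_variable:
  fixes q s u v :: complex
  assumes gen: "generic q s" and u: "1 - s * u \<noteq> 0" and v: "1 - s * v \<noteq> 0" and uv: "1 - u * v \<noteq> 0"
    and ab: "norm ((u - s) / (1 - s * u) * ((v - s) / (1 - s * v))) < 1"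
    and summable: "(\<lambda>C. row_weight (vertex_weight q s u) 1 lam C * row_weight (conj_weight q s v) 0 mu C) summable_on UNIV"
  shows "(\<Sum>\<^sub>\<infinity>C. row_weight (vertex_weight q s u) 1 lam C * row_weight (conj_weight q s v) 0 mu C) =
    (1 - q * u * v) / (1 - u * v) *
    (\<Sum>\<^sub>\<infinity>C. row_weight (conj_weight q s v) 0 C lam * row_weight (vertex_weight q s u) 1 C mu)"
    (is "infsum ?f UNIV = _ * infsum ?g UNIV")
proof (cases "size mu = size lam + 1")
  case False
  have "infsum ?f UNIV = 0"
  proof (rule infsum_0)
    fix C show "?f C = 0"
      using False row_size[of "vertex_weight q s u" 1 lam C] row_size[of "conj_weight q s v" 0 mu C] by fastforce
  qed
  moreover have "infsum ?g UNIV = 0"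
  proof (rule infsum_0)
    fix C show "?g C = 0"
      using False row_size[of "conj_weight q s v" 0 C lam] row_size[of "vertex_weight q s u" 1 C mu] by fastforce
  qed
  ultimately show ?thesis by (simp only: mult_zero_right)
next
  case True
  define k where "k = size lam + 1"
  \<comment> \<open>From column \<open>N\<close> on neither given state has an entry, so the counts
    \<open>lt_count\<close> have reached the full sizes.\<close>
  define N where "N = Suc (sum_mset lam + sum_mset mu)"
  have supp: "set_mset lam \<subseteq> {..<n}" "set_mset mu \<subseteq> {..<n}" if "n \<ge> N" for n
    using subset_sum_mset[of lam] subset_sum_mset[of mu] that by (force simp: N_def)+
  have lt: "lt_count lam n = size lam" "lt_count mu n = size lam + 1" if "n \<ge> N" for n
    using supp[OF that] True by (simp_all add: lt_count_eq_size_iff[symmetric])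
  have A: "sum_above q s u v lam mu n 0 0 = sum ?f {A. set_mset A \<subseteq> {..<n} \<and> size A = k}" if n: "n \<ge> N" for n
  proof -
    have "sum_above q s u v lam mu n 0 0 = column_sum (above_term q s u v lam mu) n k"
      using lt[OF n] by (simp add: sum_above_def k_def)
    also have "\<dots> = sum ?f {A. set_mset A \<subseteq> {..<n} \<and> size A = k}"
      unfolding column_sum_def
    proof (rule sum.cong[OF refl])
      fix C :: "nat multiset" assume C: "C \<in> {A. set_mset A \<subseteq> {..<n} \<and> size A = k}"
      have "row_weight (vertex_weight q s u) 1 lam C = (\<Prod>x<n. vertex_weight q s u (count lam x) (flux 1 lam C x) (count C x) (flux 1 lam C (Suc x)))"
        by (rule row_eq_prod) (use C supp[OF n] u vertex_weight_conserves vertex_weight_empty in \<open>auto simp: k_def\<close>)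
      moreover have "row_weight (conj_weight q s v) 0 mu C = (\<Prod>x<n. conj_weight q s v (count mu x) (flux 0 mu C x) (count C x) (flux 0 mu C (Suc x)))"
        by (rule row_eq_prod) (use C supp[OF n] v True conj_weight_conserves conj_weight_empty in \<open>auto simp: k_def\<close>)
      ultimately show "(\<Prod>x<n. above_term q s u v lam mu x (count C x) (lt_count C x)) = ?f C"
        by (simp add: above_term_def flux_def lt_count_Suc prod.distrib)
    qed
    finally show ?thesis .
  qed
  \<comment> \<open>The shared lower state lies below \<open>lam\<close>, hence within the first
    \<open>N\<close> columns. This truncation is already the full sum, and only
    \<open>sum_above\<close> involves a limit.\<close>
  have B: "sum_below q s u v lam mu n 0 0 = infsum ?g UNIV" if n: "n \<ge> N" for n
  proof -
    have "sum_below q s u v lam mu n 0 0 = column_sum (below_term q s u v lam mu) n (size lam)"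
      using lt[OF n] by (simp add: sum_below_def)
    also have "\<dots> = sum ?g {A. set_mset A \<subseteq> {..<n} \<and> size A = size lam}"
      unfolding column_sum_def
    proof (rule sum.cong[OF refl])
      fix C :: "nat multiset" assume C: "C \<in> {A. set_mset A \<subseteq> {..<n} \<and> size A = size lam}"
      have "row_weight (vertex_weight q s u) 1 C mu = (\<Prod>x<n. vertex_weight q s u (count C x) (flux 1 C mu x) (count mu x) (flux 1 C mu (Suc x)))"
        by (rule row_eq_prod) (use C supp[OF n] u True vertex_weight_conserves vertex_weight_empty in auto)
      moreover have "row_weight (conj_weight q s v) 0 C lam = (\<Prod>x<n. conj_weight q s v (count C x) (flux 0 C lam x) (count lam x) (flux 0 C lam (Suc x)))"
        by (rule row_eq_prod) (use C supp[OF n] v conj_weight_conserves conj_weight_empty in auto)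
      ultimately show "(\<Prod>x<n. below_term q s u v lam mu x (count C x) (lt_count C x)) = ?g C"
        by (simp add: below_term_def flux_def lt_count_Suc prod.distrib)
    qed
    also have "\<dots> = infsum ?g {A. set_mset A \<subseteq> {..<n} \<and> size A = size lam}"
      by (simp add: infsum_finite finite_multisets_of_size)
    also have "\<dots> = infsum ?g UNIV"
    proof (rule infsum_cong_neutral)
      fix C :: "nat multiset" assume C: "C \<in> UNIV - {A. set_mset A \<subseteq> {..<n} \<and> size A = size lam}"
      have "row_weight (conj_weight q s v) 0 C lam = 0"
      proof (rule ccontr)
        assume "\<not> ?thesis"
        then have "admissible 0 C lam" by (auto simp: row_weight_def split: if_splits)
        then show False using C admissible_support[of 0 C lam n] supp[OF n] by (auto simp: admissible_def)
      qed
      then show "?g C = 0" by simp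
    qed auto
    finally show ?thesis .
  qed
  define e where "e = (u - s) / (1 - s * u) * ((v - s) / (1 - s * v))"
  \<comment> \<open>Over empty lower states a path that leaves the \<open>u\<close>-row must have
    entered it horizontally, so the shared upper state is empty in this column and the path of the
    \<open>v\<close>-row goes straight through as well.\<close>
  have step: "sum_above q s u v lam mu (Suc n) 1 1 = e * sum_above q s u v lam mu n 1 1" if n: "n \<ge> N" for n
  proof -
    have "count lam n = 0" "count mu n = 0" using supp[OF n] by (auto simp: count_eq_zero_iff)
    then show ?thesis
      by (simp add: sum_above_Suc numeral_2_eq_2 column_above_def e_def vertex_weight_def conj_weight_eq[OF gen])
  qed
  have "sum_above q s u v lam mu (N + n) 1 1 = e ^ n * sum_above q s u v lam mu N 1 1" for n
  proof (induction n)
    case (Suc n)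
    then show ?case using step[of "N + n"] by (simp only: add_Suc_right power_Suc mult.assoc)
  qed simp
  moreover have "(\<lambda>n. e ^ n * sum_above q s u v lam mu N 1 1) \<longlonglongrightarrow> 0 * sum_above q s u v lam mu N 1 1"
    using ab by (intro tendsto_intros LIMSEQ_power_zero) (simp add: e_def)
  ultimately have lim11: "(\<lambda>n. sum_above q s u v lam mu (N + n) 1 1) \<longlonglongrightarrow> 0" by simp
  have lim00: "(\<lambda>n. sum_above q s u v lam mu (N + n) 0 0) \<longlonglongrightarrow> infsum ?f UNIV"
  proof -
    have "infsum ?f UNIV = infsum ?f {A. size A = k}"
    proof (rule infsum_cong_neutral)
      fix C :: "nat multiset" assume "C \<in> UNIV - {A. size A = k}"
      then have "row_weight (vertex_weight q s u) 1 lam C = 0"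
        using row_size[of "vertex_weight q s u" 1 lam C] by (auto simp: k_def)
      then show "?f C = 0" by simp
    qed auto
    moreover have "?f summable_on {A. size A = k}"
      by (rule summable_on_subset_banach[OF summable]) simp
    ultimately have "(sum ?f \<longlongrightarrow> infsum ?f UNIV) (finite_subsets_at_top {A. size A = k})"
      using has_sum_infsum[of ?f "{A. size A = k}"] by (simp only: has_sum_def)
    then have "(\<lambda>n. sum ?f {A. set_mset A \<subseteq> {..<n} \<and> size A = k}) \<longlonglongrightarrow> infsum ?f UNIV"
      by (rule filterlim_compose[OF _ filterlim_bounded_multisets])
    then have "(\<lambda>n. sum ?f {A. set_mset A \<subseteq> {..<n + N} \<and> size A = k}) \<longlonglongrightarrow> infsum ?f UNIV"
      by (rule LIMSEQ_ignore_initial_segment)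
    then show ?thesis by (simp add: A add.commute)
  qed
  \<comment> \<open>At \<open>p = p' = 0\<close> the only nonzero entries of \<open>cross\<close>
    are \<open>1 - u * v\<close> for the pair \<open>(0, 0)\<close> and \<open>1 - q\<close> for the
    pair \<open>(1, 1)\<close>.\<close>
  have "(1 - q * u * v) * infsum ?g UNIV = (1 - u * v) * sum_above q s u v lam mu (N + n) 0 0
      + (1 - q) * sum_above q s u v lam mu (N + n) 1 1" for n
    using sum_below_eq_cross_above[OF gen, of 0 0 u v lam mu "N + n"]
    by (simp add: B numeral_2_eq_2 cross_def algebra_simps)
  moreover have "(\<lambda>n. (1 - u * v) * sum_above q s u v lam mu (N + n) 0 0
      + (1 - q) * sum_above q s u v lam mu (N + n) 1 1) \<longlonglongrightarrow> (1 - u * v) * infsum ?f UNIV + (1 - q) * 0"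
    by (intro tendsto_intros lim00 lim11)
  ultimately have "(\<lambda>n. (1 - q * u * v) * infsum ?g UNIV) \<longlonglongrightarrow> (1 - u * v) * infsum ?f UNIV"
    by simp
  then have "(1 - q * u * v) * infsum ?g UNIV = (1 - u * v) * infsum ?f UNIV"
    by (simp add: LIMSEQ_const_iff)
  then show ?thesis using uv by (simp add: field_simps)
qed

section \<open>Growth of kernels\<close>

type_synonym kernel = "nat multiset \<Rightarrow> nat multiset \<Rightarrow> complex"

text \<open>Removing the largest entry embeds multisets of size \<open>Suc L\<close> into pairs of a
  number and a multiset of size \<open>L\<close>. Only injectivity is used: the series is a
  subseries of a product of a geometric series with the previous one.\<close>

lemma summable_power_sum_mset:
  fixes t :: real
  assumes "0 \<le> t" "t < 1"
  shows "(\<lambda>A. t ^ sum_mset A) summable_on {A :: nat multiset. size A = L}"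
proof (induction L)
  case 0
  then show ?case by simp
next
  case (Suc L)
  let ?S = "{A :: nat multiset. size A = L}"
  let ?h = "\<lambda>A :: nat multiset. (Max_mset A, A - {#Max_mset A#})"
  have h: "Max_mset A \<in># A" if "size A = Suc L" for A :: "nat multiset"
    using that by (intro Max_in) (auto simp: size_eq_Suc_imp_elem)
  have geo: "(\<lambda>x::nat. t ^ x) summable_on UNIV"
    using assms by (intro norm_summable_imp_summable_on) (simp add: summable_geometric)
  have "(\<lambda>(x, A). t ^ x * t ^ sum_mset A) summable_on (UNIV \<times> ?S)"
  proof (rule summable_on_SigmaI)
    fix x :: nat
    show "((\<lambda>A. case (x, A) of (x, A) \<Rightarrow> t ^ x * t ^ sum_mset A) has_sum t ^ x * (\<Sum>\<^sub>\<infinity>A\<in>?S. t ^ sum_mset A)) ?S"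
      using Suc.IH by (simp add: has_sum_cmult_right)
    show "(\<lambda>x. t ^ x * (\<Sum>\<^sub>\<infinity>A\<in>?S. t ^ sum_mset A)) summable_on UNIV"
      by (rule summable_on_cmult_left[OF geo])
  qed (use assms in auto)
  then have "(\<lambda>(x, A). t ^ x * t ^ sum_mset A) summable_on (?h ` {A. size A = Suc L})"
    by (rule summable_on_subset_banach) (auto simp: h size_Diff_singleton)
  moreover have "inj_on ?h {A. size A = Suc L}"
  proof (rule inj_onI)
    fix A B :: "nat multiset" assume "A \<in> {A. size A = Suc L}" "B \<in> {A. size A = Suc L}" "?h A = ?h B"
    then have "add_mset (Max_mset A) (A - {#Max_mset A#}) = add_mset (Max_mset B) (B - {#Max_mset B#})"
      unfolding prod.inject by (elim conjE) (simp only:)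
    then show "A = B" using h \<open>A \<in> _\<close> \<open>B \<in> _\<close> by simp
  qed
  ultimately have "((\<lambda>(x, A). t ^ x * t ^ sum_mset A) \<circ> ?h) summable_on {A. size A = Suc L}"
    by (simp add: summable_on_reindex)
  moreover have "((\<lambda>(x, A). t ^ x * t ^ sum_mset A) \<circ> ?h) A = t ^ sum_mset A" if "size A = Suc L" for A
  proof -
    have "A = add_mset (Max_mset A) (A - {#Max_mset A#})" using h[OF that] by simp
    then have "sum_mset A = Max_mset A + sum_mset (A - {#Max_mset A#})" by (metis sum_mset.add_mset)
    then show ?thesis by (simp add: power_add)
  qed
  then have "((\<lambda>(x, A). t ^ x * t ^ sum_mset A) \<circ> ?h) summable_on {A. size A = Suc L} \<longleftrightarrow>
      (\<lambda>A. t ^ sum_mset A) summable_on {A. size A = Suc L}"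
    by (intro summable_on_cong) simp
  ultimately show ?case by simp
qed

text \<open>Double counting: an entry \<open>a\<close> is counted in the \<open>n - a\<close>
  columns from \<open>a\<close> to \<open>n - 1\<close>.\<close>

lemma sum_lt_count:
  "set_mset A \<subseteq> {..<n} \<Longrightarrow> (\<Sum>x<n. lt_count A (Suc x)) + sum_mset A = n * size A"
proof (induction A)
  case (add a A)
  have "lt_count (add_mset a A) x = lt_count A x + (if a < x then 1 else 0)" for x
    by (simp add: lt_count_def)
  moreover have "(\<Sum>x<n. if a < Suc x then 1 else 0) = n - a"
  proof -
    have "{x. x < n \<and> a < Suc x} = {a..<n}" by auto
    then show ?thesis by (simp add: sum.If_cases Int_def)
  qed
  ultimately show ?case using add by (simp add: sum.distrib)
qed (simp add: lt_count_def)

text \<open>The number of horizontal edges used to the right of column 0 is the total displacement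
  of the paths, where those entering from the left count as starting at column 0.\<close>

lemma sum_flux:
  assumes "admissible b A B" "set_mset A \<subseteq> {..<n}" "set_mset B \<subseteq> {..<n}"
  shows "(\<Sum>x<n. flux b A B (Suc x)) + sum_mset A = sum_mset B"
proof -
  have "(\<Sum>x<n. flux b A B (Suc x) + lt_count B (Suc x)) = (\<Sum>x<n. b + lt_count A (Suc x))"
    using assms(1) by (intro sum.cong) (auto simp: flux_def admissible_def)
  then have "(\<Sum>x<n. flux b A B (Suc x)) + (\<Sum>x<n. lt_count B (Suc x)) = n * b + (\<Sum>x<n. lt_count A (Suc x))"
    by (simp add: sum.distrib)
  moreover have "size B = size A + b" using assms(1) by (simp add: admissible_def)
  then have "n * size B = n * size A + n * b" by (simp add: algebra_simps)
  ultimately show ?thesis using sum_lt_count[OF assms(2)] sum_lt_count[OF assms(3)] by linarith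
qed

text \<open>In a column without vertical edges the weight is 1 or \<open>W 0 1 0 1\<close>, so it is
  at most \<open>t\<close> to the power of the outgoing flux. By \<open>sum_flux\<close> these
  powers multiply to the quotient in the bound, and at most \<open>2 * L + b\<close> columns are
  exceptional.\<close>

lemma row_bound:
  fixes t :: real
  assumes W: "\<And>i1 j1 i2 j2. W i1 j1 i2 j2 \<noteq> 0 \<Longrightarrow> i1 + j1 = i2 + j2 \<and> j1 < 2 \<and> j2 < 2"
    and W0: "W 0 0 0 0 = 1" and W1: "norm (W 0 1 0 1) \<le> t" and t: "t > 0"
  shows "\<exists>C. \<forall>A B. size A = L \<longrightarrow> norm (row_weight W b A B) \<le> C * t ^ sum_mset B / t ^ sum_mset A"
proof -
  define S where "S = {..L + b} \<times> {..<2::nat} \<times> {..L + b} \<times> {..<2::nat}"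
  define K where "K = 1 + (\<Sum>(i1, j1, i2, j2)\<in>S. norm (W i1 j1 i2 j2))"
  \<comment> \<open>An exceptional column is also credited with a power of \<open>t\<close>, which
    may be small. The summand \<open>1 / t\<close> ensures \<open>K \<le> D * t\<close> in addition
    to \<open>K \<le> D\<close>.\<close>
  define D where "D = K * (1 + 1 / t)"
  have K1: "1 \<le> K" unfolding K_def by (auto intro!: sum_nonneg)
  have "D = K + K / t" "D * t = K * t + K" using t by (simp_all add: D_def field_simps)
  moreover have "0 \<le> K / t" "0 \<le> K * t" using K1 t by auto
  ultimately have D1: "1 \<le> D" "K \<le> D" "K \<le> D * t" using K1 by linarith+
  have WK: "norm (W i1 j1 i2 j2) \<le> K" if "i1 \<le> L + b" "i2 \<le> L + b" for i1 j1 i2 j2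
  proof (cases "W i1 j1 i2 j2 = 0")
    case False
    then have "(i1, j1, i2, j2) \<in> S" using that W by (auto simp: S_def)
    moreover have "finite S" by (simp add: S_def)
    ultimately have "(\<lambda>(i1, j1, i2, j2). norm (W i1 j1 i2 j2)) (i1, j1, i2, j2) \<le>
        (\<Sum>(i1, j1, i2, j2)\<in>S. norm (W i1 j1 i2 j2))"
      by (intro member_le_sum) auto
    then show ?thesis by (simp add: K_def)
  qed (use K1 in simp)
  have "norm (row_weight W b A B) \<le> D ^ (2 * L + b) * t ^ sum_mset B / t ^ sum_mset A" if L: "size A = L" for A B
  proof (cases "admissible b A B")
    case False
    then show ?thesis using D1 t by (simp add: row_weight_def)
  next
    case True
    define n where "n = Suc (sum_mset B)"
    have supp: "set_mset B \<subseteq> {..<n}" "set_mset A \<subseteq> {..<n}"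
      using subset_sum_mset[of B] admissible_support[OF True] by (auto simp: n_def)
    define E where "E = set_mset A \<union> set_mset B"
    have factor: "norm (W (count A x) (flux b A B x) (count B x) (flux b A B (Suc x))) \<le>
        (if x \<in> E then D else 1) * t ^ flux b A B (Suc x)" (is "norm ?w \<le> _") for x
    proof (cases "?w = 0")
      case nz: False
      have j2: "flux b A B (Suc x) = 0 \<or> flux b A B (Suc x) = 1" using W[OF nz] by linarith
      show ?thesis
      proof (cases "x \<in> E")
        case x: True
        have "count A x \<le> L + b" "count B x \<le> L + b"
          using L True count_le_size[of A x] count_le_size[of B x] by (auto simp: admissible_def)
        then have "norm ?w \<le> K" by (rule WK)
        then show ?thesis using j2 D1 x by auto
      next
        case False
        then have "count A x = 0" "count B x = 0" by (auto simp: E_def count_eq_zero_iff)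
        then show ?thesis using False W[OF nz] j2 W0 W1 by auto
      qed
    qed (use D1 t in auto)
    have "norm (row_weight W b A B) = (\<Prod>x<n. norm (W (count A x) (flux b A B x) (count B x) (flux b A B (Suc x))))"
      using row_eq[of b A B n W, OF True supp(1) W0] by (simp add: prod_norm)
    also have "\<dots> \<le> (\<Prod>x<n. (if x \<in> E then D else 1) * t ^ flux b A B (Suc x))"
      by (rule prod_mono) (use factor in auto)
    also have "\<dots> = (\<Prod>x<n. if x \<in> E then D else 1) * t ^ (\<Sum>x<n. flux b A B (Suc x))"
      by (simp add: prod.distrib power_sum)
    also have "(\<Prod>x<n. if x \<in> E then D else 1) = D ^ card E"
    proof -
      have "{..<n} \<inter> {x. x \<in> E} = E" using supp by (auto simp: E_def)
      then show ?thesis by (simp add: prod.If_cases)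
    qed
    also have "t ^ (\<Sum>x<n. flux b A B (Suc x)) = t ^ sum_mset B / t ^ sum_mset A"
      using sum_flux[OF True supp(2,1)] t by (metis add_diff_cancel_right' le_add2 less_irrefl power_diff)
    finally have "norm (row_weight W b A B) \<le> D ^ card E * (t ^ sum_mset B / t ^ sum_mset A)" .
    moreover have "card E \<le> 2 * L + b"
    proof -
      have "card E \<le> card (set_mset A) + card (set_mset B)" unfolding E_def by (rule card_Un_le)
      moreover have "card (set_mset C) \<le> size C" for C :: "nat multiset"
        using size_mset_mono[OF mset_set_set_mset_msubset[of C]] by simp
      from this[of A] this[of B] have "card (set_mset A) + card (set_mset B) \<le> size A + size B" by simp
      ultimately show ?thesis using L True by (simp add: admissible_def)
    qed
    then have "D ^ card E \<le> D ^ (2 * L + b)" by (rule power_increasing) (rule D1)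
    ultimately show ?thesis
      using t by (smt (verit) divide_nonneg_nonneg mult_right_mono times_divide_eq_right zero_le_power)
  qed
  then show ?thesis by blast
qed

text \<open>The two rates \<open>t' < t\<close> leave room for a convergent geometric series over the intermediate state
  when two kernels are composed.\<close>

definition growth :: "real \<Rightarrow> kernel \<Rightarrow> bool" where
  "growth a K \<longleftrightarrow> (\<forall>B. finite {A. K A B \<noteq> 0}) \<and> (\<exists>b. \<forall>A B. K A B \<noteq> 0 \<longrightarrow> size B = size A + b) \<and>
     (\<forall>L t' t. a < t' \<longrightarrow> t' < t \<longrightarrow>
       (\<exists>C\<ge>0. \<forall>A B. size A = L \<longrightarrow> norm (K A B) \<le> C * t ^ sum_mset B / t' ^ sum_mset A))"

text \<open>Written as an infinite sum so that it can be interchanged with the infinite sums in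
  \<open>intertwine\<close>. For kernels satisfying \<open>growth\<close> only finitely many terms
  are nonzero.\<close>

definition kernel_comp :: "kernel \<Rightarrow> kernel \<Rightarrow> kernel" where
  "kernel_comp K1 K2 A B = (\<Sum>\<^sub>\<infinity>C. K1 A C * K2 C B)"

definition id_kernel :: kernel where
  "id_kernel A B = (if A = B then 1 else 0)"

lemma growth_finite: "growth a K \<Longrightarrow> finite {A. K A B \<noteq> 0}"
  by (simp add: growth_def)

lemma growth_size:
  assumes "growth a K"
  obtains b where "\<And>A B. K A B \<noteq> 0 \<Longrightarrow> size B = size A + b"
  using assms unfolding growth_def by blast

lemma growth_bound:
  assumes "growth a K" "a < t'" "t' < t"
  obtains C where "C \<ge> 0" "\<And>A B. size A = L \<Longrightarrow> norm (K A B) \<le> C * t ^ sum_mset B / t' ^ sum_mset A"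
  using assms unfolding growth_def by meson

lemma growth_row:
  assumes W: "\<And>i1 j1 i2 j2. W i1 j1 i2 j2 \<noteq> 0 \<Longrightarrow> i1 + j1 = i2 + j2 \<and> j1 < 2 \<and> j2 < 2"
    and W0: "W 0 0 0 0 = 1" and W1: "norm (W 0 1 0 1) \<le> a"
  shows "growth a (row_weight W b)"
  unfolding growth_def
proof (intro conjI allI impI)
  show "finite {A. row_weight W b A B \<noteq> 0}" for B
    by (rule finite_subset[OF _ finite_below[of b B]]) (auto simp: below_def row_weight_def split: if_splits)
  show "\<exists>d. \<forall>A B. row_weight W b A B \<noteq> 0 \<longrightarrow> size B = size A + d"
    using row_size by blast
  fix L and t' t :: real assume t: "a < t'" "t' < t"
  have a: "0 \<le> a" using W1 norm_ge_zero order_trans by blast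
  have "0 < t" "norm (W 0 1 0 1) \<le> t" using t a W1 by auto
  from row_bound[of W t L b, OF W W0 this(2,1)] obtain C where
    C: "\<And>A B. size A = L \<Longrightarrow> norm (row_weight W b A B) \<le> C * t ^ sum_mset B / t ^ sum_mset A" by blast
  have "norm (row_weight W b A B) \<le> \<bar>C\<bar> * t ^ sum_mset B / t' ^ sum_mset A" if "size A = L" for A B
  proof -
    have "norm (row_weight W b A B) \<le> C * t ^ sum_mset B / t ^ sum_mset A" by (rule C[OF that])
    also have "\<dots> \<le> \<bar>C\<bar> * t ^ sum_mset B / t ^ sum_mset A"
      using t a by (intro divide_right_mono mult_right_mono) auto
    also have "\<dots> \<le> \<bar>C\<bar> * t ^ sum_mset B / t' ^ sum_mset A"
      using t a by (intro divide_left_mono power_mono mult_nonneg_nonneg mult_pos_pos) auto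
    finally show ?thesis .
  qed
  then show "\<exists>C\<ge>0. \<forall>A B. size A = L \<longrightarrow> norm (row_weight W b A B) \<le> C * t ^ sum_mset B / t' ^ sum_mset A"
    by (intro exI[of _ "\<bar>C\<bar>"]) auto
qed

lemma growth_id: "0 \<le> a \<Longrightarrow> growth a id_kernel"
  unfolding growth_def id_kernel_def
  by (auto intro!: exI[of _ 0] exI[of _ 1] simp: divide_simps intro!: power_mono)

lemma comp_eq_sum:
  assumes "finite {C. K2 C B \<noteq> 0}"
  shows "kernel_comp K1 K2 A B = (\<Sum>C | K2 C B \<noteq> 0. K1 A C * K2 C B)"
proof -
  have "kernel_comp K1 K2 A B = (\<Sum>\<^sub>\<infinity>C\<in>{C. K2 C B \<noteq> 0}. K1 A C * K2 C B)"
    unfolding kernel_comp_def by (rule infsum_cong_neutral) auto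
  then show ?thesis using assms by simp
qed

lemma growth_comp:
  assumes "0 \<le> a" and K1: "growth a K1" and K2: "growth a K2"
  shows "growth a (kernel_comp K1 K2)"
proof -
  obtain b1 where b1: "\<And>A B. K1 A B \<noteq> 0 \<Longrightarrow> size B = size A + b1" using growth_size[OF K1] by blast
  obtain b2 where b2: "\<And>A B. K2 A B \<noteq> 0 \<Longrightarrow> size B = size A + b2" using growth_size[OF K2] by blast
  have nz: "\<exists>C. K1 A C \<noteq> 0 \<and> K2 C B \<noteq> 0" if "kernel_comp K1 K2 A B \<noteq> 0" for A B
  proof (rule ccontr)
    assume "\<not> ?thesis"
    then have "kernel_comp K1 K2 A B = 0" unfolding kernel_comp_def by (intro infsum_0) auto
    then show False using that by simp
  qed
  show ?thesis unfolding growth_def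
  proof (intro conjI allI impI)
    fix B
    have "{A. kernel_comp K1 K2 A B \<noteq> 0} \<subseteq> (\<Union>C\<in>{C. K2 C B \<noteq> 0}. {A. K1 A C \<noteq> 0})" using nz by blast
    then show "finite {A. kernel_comp K1 K2 A B \<noteq> 0}"
      using growth_finite[OF K1] growth_finite[OF K2] by (meson finite_UN_I finite_subset)
  next
    show "\<exists>b. \<forall>A B. kernel_comp K1 K2 A B \<noteq> 0 \<longrightarrow> size B = size A + b"
    proof (intro exI allI impI)
      fix A B assume "kernel_comp K1 K2 A B \<noteq> 0"
      then obtain C where "K1 A C \<noteq> 0" "K2 C B \<noteq> 0" using nz by blast
      then show "size B = size A + (b1 + b2)" using b1 b2 by simp
    qed
  next
    fix L and t' t :: real assume t: "a < t'" "t' < t"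
    \<comment> \<open>\<open>K1\<close> uses the rates \<open>t' < t1\<close> and \<open>K2\<close>
      the rates \<open>t2 < t\<close>. An intermediate state \<open>C\<close> is then weighted by
      \<open>(t1 / t2) ^ sum_mset C\<close>, which is summable because
      \<open>t1 < t2\<close>.\<close>
    define t1 where "t1 = t' + (t - t') / 3"
    define t2 where "t2 = t' + 2 * (t - t') / 3"
    have t12: "t' < t1" "t1 < t2" "t2 < t" using t by (auto simp: t1_def t2_def field_simps)
    obtain C1 where C1: "C1 \<ge> 0"
      "\<And>A B. size A = L \<Longrightarrow> norm (K1 A B) \<le> C1 * t1 ^ sum_mset B / t' ^ sum_mset A"
      using growth_bound[OF K1 t(1) t12(1), of L] by blast
    obtain C2 where C2: "C2 \<ge> 0"
      "\<And>A B. size A = L + b1 \<Longrightarrow> norm (K2 A B) \<le> C2 * t ^ sum_mset B / t2 ^ sum_mset A"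
      using growth_bound[OF K2 _ t12(3), of "L + b1"] t t12 by (metis less_trans)
    let ?Z = "{A :: nat multiset. size A = L + b1}"
    have "0 \<le> t1 / t2" "t1 / t2 < 1" using assms(1) t t12 by auto
    from summable_power_sum_mset[OF this, of "L + b1"]
    have sm: "(\<lambda>A. (t1 / t2) ^ sum_mset A) summable_on ?Z" .
    define S where "S = (\<Sum>\<^sub>\<infinity>A\<in>?Z. (t1 / t2) ^ sum_mset A)"
    have pos: "0 < t'" "0 < t1" "0 < t2" "0 < t" using assms(1) t t12 by auto
    have S0: "S \<ge> 0" unfolding S_def using pos by (intro infsum_nonneg) auto
    have "norm (kernel_comp K1 K2 A B) \<le> (C1 * C2 * S) * t ^ sum_mset B / t' ^ sum_mset A" if L: "size A = L" for A B
    proof -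
      let ?F = "{C. K2 C B \<noteq> 0} \<inter> ?Z"
      define c where "c = C1 * C2 * t ^ sum_mset B / t' ^ sum_mset A"
      have "kernel_comp K1 K2 A B = (\<Sum>C | K2 C B \<noteq> 0. K1 A C * K2 C B)"
        by (rule comp_eq_sum[OF growth_finite[OF K2]])
      also have "\<dots> = (\<Sum>C\<in>?F. K1 A C * K2 C B)"
        using b1 L growth_finite[OF K2] by (intro sum.mono_neutral_right) auto
      finally have "norm (kernel_comp K1 K2 A B) \<le> (\<Sum>C\<in>?F. norm (K1 A C * K2 C B))"
        by (simp add: norm_sum)
      also have "\<dots> \<le> (\<Sum>C\<in>?F. c * (t1 / t2) ^ sum_mset C)"
      proof (rule sum_mono)
        fix C assume "C \<in> ?F"
        then have "size C = L + b1" by simp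
        have "norm (K1 A C * K2 C B) \<le> (C1 * t1 ^ sum_mset C / t' ^ sum_mset A) * (C2 * t ^ sum_mset B / t2 ^ sum_mset C)"
          unfolding norm_mult using C1 C2 L \<open>size C = L + b1\<close> pos by (intro mult_mono) auto
        also have "\<dots> = c * (t1 / t2) ^ sum_mset C" by (simp add: c_def power_divide)
        finally show "norm (K1 A C * K2 C B) \<le> c * (t1 / t2) ^ sum_mset C" .
      qed
      also have "\<dots> = c * (\<Sum>C\<in>?F. (t1 / t2) ^ sum_mset C)" by (simp add: sum_distrib_left)
      also have "\<dots> \<le> c * S"
        unfolding S_def using pos C1(1) C2(1) growth_finite[OF K2, of B]
        by (intro mult_left_mono finite_sum_le_infsum sm) (auto simp: c_def)
      finally show ?thesis by (simp add: c_def mult_ac)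
    qed
    then show "\<exists>C\<ge>0. \<forall>A B. size A = L \<longrightarrow> norm (kernel_comp K1 K2 A B) \<le> C * t ^ sum_mset B / t' ^ sum_mset A"
      using C1(1) C2(1) S0 by (intro exI[of _ "C1 * C2 * S"]) auto
  qed
qed

lemma less_one_product_slack:
  fixes a b :: real
  assumes "0 \<le> a" "0 \<le> b" "a * b < 1"
  obtains e where "0 < e" "(a + e) * (b + e) < 1"
proof
  \<comment> \<open>Chosen so that \<open>e * (a + b + 1)\<close> is half of the gap
    \<open>1 - a * b\<close>; since \<open>e \<le> 1\<close>, the quadratic term
    \<open>e * e\<close> is absorbed into this.\<close>
  define e where "e = (1 - a * b) / (2 * (a + b + 1))"
  show e: "0 < e" using assms by (simp add: e_def)
  have "0 \<le> a * b" using assms by simp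
  then have "1 - a * b \<le> 1" by simp
  also have "1 \<le> 2 * (a + b + 1)" using assms by simp
  finally have "1 - a * b \<le> 2 * (a + b + 1)" .
  then have "e \<le> 1" using assms unfolding e_def by (subst divide_le_eq_1_pos) auto
  then have "e * e \<le> e * 1" using e by (intro mult_left_mono) auto
  then have "(a + e) * (b + e) \<le> a * b + e * (a + b + 1)" by (simp add: algebra_simps)
  also have "e * (a + b + 1) = (1 - a * b) / 2" using assms by (simp add: e_def field_simps)
  finally show "(a + e) * (b + e) < 1" using assms by (simp add: field_simps)
qed

section \<open>Intertwining kernels\<close>

definition intertwine :: "kernel \<Rightarrow> kernel \<Rightarrow> complex \<Rightarrow> bool" where
  "intertwine F G c \<longleftrightarrow>
    (\<forall>lam mu. (\<Sum>\<^sub>\<infinity>C. F lam C * G mu C) = c * (\<Sum>\<^sub>\<infinity>C. G C lam * F C mu))"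

text \<open>Because of this symmetry one composition lemma serves for the rows of both
  families.\<close>

lemma intertwine_sym: "intertwine F G c \<Longrightarrow> intertwine G F c"
  by (simp add: intertwine_def mult.commute)

lemma intertwine_id: "intertwine F id_kernel 1"
proof -
  have "(\<Sum>\<^sub>\<infinity>C. F lam C * id_kernel mu C) = F lam mu" for lam mu
    using infsum_cong_neutral[of "{mu}" UNIV "\<lambda>C. F lam C * id_kernel mu C" "\<lambda>C. F lam C * id_kernel mu C"]
    by (simp add: id_kernel_def)
  moreover have "(\<Sum>\<^sub>\<infinity>C. id_kernel C lam * F C mu) = F lam mu" for lam mu
    using infsum_cong_neutral[of "{lam}" UNIV "\<lambda>C. id_kernel C lam * F C mu" "\<lambda>C. id_kernel C lam * F C mu"]
    by (simp add: id_kernel_def)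
  ultimately show ?thesis by (simp add: intertwine_def)
qed

text \<open>Both rates can be raised by \<open>e\<close> with their product still below 1, which
  dominates the summand by a geometric term. The kernel \<open>F\<close> fixes the size of
  \<open>C\<close>, so only multisets of one size matter.\<close>

lemma summable_growth_product:
  assumes F: "growth a F" and G: "growth a' G" and a: "0 \<le> a" "0 \<le> a'" "a * a' < 1"
  shows "(\<lambda>C. F lam C * G mu C) summable_on UNIV"
proof -
  obtain e where e: "0 < e" "(a + e) * (a' + e) < 1" using less_one_product_slack[OF a] .
  obtain C1 where C1: "C1 \<ge> 0"
    "\<And>A B. size A = size lam \<Longrightarrow> norm (F A B) \<le> C1 * (a + e) ^ sum_mset B / (a + e / 2) ^ sum_mset A"
    using growth_bound[OF F, of "a + e / 2" "a + e" "size lam"] e by auto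
  obtain C2 where C2: "C2 \<ge> 0"
    "\<And>A B. size A = size mu \<Longrightarrow> norm (G A B) \<le> C2 * (a' + e) ^ sum_mset B / (a' + e / 2) ^ sum_mset A"
    using growth_bound[OF G, of "a' + e / 2" "a' + e" "size mu"] e by auto
  obtain b where b: "\<And>A B. F A B \<noteq> 0 \<Longrightarrow> size B = size A + b" using growth_size[OF F] by blast
  define K where "K = C1 / (a + e / 2) ^ sum_mset lam * (C2 / (a' + e / 2) ^ sum_mset mu)"
  let ?t = "(a + e) * (a' + e)"
  let ?S = "{C :: nat multiset. size C = size lam + b}"
  have "(\<lambda>C. K * ?t ^ sum_mset C) summable_on ?S"
    by (intro summable_on_cmult_right summable_power_sum_mset) (use a e in auto)
  then have "(\<lambda>C. norm (F lam C * G mu C)) summable_on ?S"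
  proof (rule Infinite_Sum.abs_summable_on_comparison_test')
    fix C
    have "norm (F lam C * G mu C) \<le> (C1 * (a + e) ^ sum_mset C / (a + e / 2) ^ sum_mset lam) *
        (C2 * (a' + e) ^ sum_mset C / (a' + e / 2) ^ sum_mset mu)"
      unfolding norm_mult using C1 C2 a e by (intro mult_mono) auto
    also have "\<dots> = K * ?t ^ sum_mset C" by (simp add: K_def power_mult_distrib)
    finally show "norm (F lam C * G mu C) \<le> K * ?t ^ sum_mset C" .
  qed
  then have "(\<lambda>C. F lam C * G mu C) summable_on ?S" by (rule abs_summable_summable)
  then show ?thesis
    by (rule summable_on_cong_neutral[THEN iffD1, rotated -1]) (use b in auto)
qed

lemma infsum_finite_sum:
  fixes f :: "'a \<Rightarrow> 'b \<Rightarrow> complex"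
  assumes "finite K" "\<And>k. k \<in> K \<Longrightarrow> f k summable_on A"
  shows "(\<Sum>\<^sub>\<infinity>x\<in>A. \<Sum>k\<in>K. f k x) = (\<Sum>k\<in>K. infsum (f k) A)"
proof -
  have "((\<lambda>x. \<Sum>k\<in>K. f k x) has_sum (\<Sum>k\<in>K. infsum (f k) A)) A"
    using assms by (induction K) (auto intro!: has_sum_add)
  then show ?thesis by (rule infsumI)
qed

text \<open>Provides the absolute convergence needed to interchange the sums over \<open>C\<close>
  and \<open>D\<close> when two \<open>G\<close>-kernels are composed. The sum over \<open>D\<close>
  converges since \<open>t1 < t2\<close>, the sum over \<open>C\<close> since
  \<open>(a + e) * t3 < 1\<close>.\<close>

lemma summable_growth_triple:
  assumes F: "growth a F" and G1: "growth a' G1" and G2: "growth a' G2"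
    and a: "0 \<le> a" "0 \<le> a'" "a * a' < 1"
  shows "(\<lambda>(C, D). F lam C * (G1 mu D * G2 D C)) summable_on UNIV"
proof -
  obtain e where e: "0 < e" "(a + e) * (a' + e) < 1" using less_one_product_slack[OF a] .
  obtain b where b: "\<And>A B. F A B \<noteq> 0 \<Longrightarrow> size B = size A + b" using growth_size[OF F] by blast
  obtain b1 where b1: "\<And>A B. G1 A B \<noteq> 0 \<Longrightarrow> size B = size A + b1" using growth_size[OF G1] by blast
  define t1 where "t1 = a' + e / 4"
  define t2 where "t2 = a' + e / 2"
  define t3 where "t3 = a' + e"
  have t: "0 < t1" "t1 < t2" "t2 < t3" using a e by (auto simp: t1_def t2_def t3_def)
  obtain C0 where C0: "C0 \<ge> 0"
    "\<And>A B. size A = size lam \<Longrightarrow> norm (F A B) \<le> C0 * (a + e) ^ sum_mset B / (a + e / 2) ^ sum_mset A"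
    using growth_bound[OF F, of "a + e / 2" "a + e" "size lam"] e by auto
  obtain C1 where C1: "C1 \<ge> 0"
    "\<And>A B. size A = size mu \<Longrightarrow> norm (G1 A B) \<le> C1 * t1 ^ sum_mset B / (a' + e / 8) ^ sum_mset A"
    using growth_bound[OF G1, of "a' + e / 8" t1 "size mu"] e by (auto simp: t1_def)
  obtain C2 where C2: "C2 \<ge> 0"
    "\<And>A B. size A = size mu + b1 \<Longrightarrow> norm (G2 A B) \<le> C2 * t3 ^ sum_mset B / t2 ^ sum_mset A"
    using growth_bound[OF G2, of t2 t3 "size mu + b1"] e t by (auto simp: t2_def)
  define K where "K = C0 / (a + e / 2) ^ sum_mset lam * (C1 / (a' + e / 8) ^ sum_mset mu) * C2"
  let ?S = "{C :: nat multiset. size C = size lam + b}" and ?T = "{C :: nat multiset. size C = size mu + b1}"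
  let ?f = "\<lambda>(C, D). F lam C * (G1 mu D * G2 D C)"
  let ?p = "\<lambda>C. ((a + e) * t3) ^ sum_mset C" and ?r = "\<lambda>D. (t1 / t2) ^ sum_mset D"
  have p: "?p summable_on ?S"
    by (intro summable_power_sum_mset) (use a e t in \<open>auto simp: t3_def\<close>)
  have r: "?r summable_on ?T"
    by (intro summable_power_sum_mset) (use t in auto)
  have "(\<lambda>(C, D). K * (?p C * ?r D)) summable_on (?S \<times> ?T)"
  proof (rule summable_on_SigmaI)
    fix C :: "nat multiset"
    show "((\<lambda>D. case (C, D) of (C, D) \<Rightarrow> K * (?p C * ?r D)) has_sum K * (?p C * infsum ?r ?T)) ?T"
      using r by (simp only: prod.case) (intro has_sum_cmult_right has_sum_infsum)
    show "(\<lambda>C. K * (?p C * infsum ?r ?T)) summable_on ?S"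
      by (intro summable_on_cmult_right summable_on_cmult_left p)
  qed (use a e t C0(1) C1(1) C2(1) in \<open>auto simp: K_def\<close>)
  then have "(\<lambda>x. norm (?f x)) summable_on (?S \<times> ?T)"
  proof (rule Infinite_Sum.abs_summable_on_comparison_test', safe)
    fix C D :: "nat multiset" assume D: "size D = size mu + b1"
    have "norm (F lam C * (G1 mu D * G2 D C)) \<le> (C0 * (a + e) ^ sum_mset C / (a + e / 2) ^ sum_mset lam) *
        ((C1 * t1 ^ sum_mset D / (a' + e / 8) ^ sum_mset mu) * (C2 * t3 ^ sum_mset C / t2 ^ sum_mset D))"
      unfolding norm_mult using C0 C1 C2 a e t D by (intro mult_mono mult_nonneg_nonneg) auto
    also have "\<dots> = K * (?p C * ?r D)" by (simp add: K_def power_mult_distrib power_divide mult_ac)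
    finally show "norm (F lam C * (G1 mu D * G2 D C)) \<le> K * (?p C * ?r D)" .
  qed
  then have "?f summable_on (?S \<times> ?T)" by (rule abs_summable_summable)
  then show ?thesis
    by (rule summable_on_cong_neutral[THEN iffD1, rotated -1]) (use b b1 in auto)
qed

text \<open>\<open>F\<close> and the upper kernel \<open>G2\<close> meet in the shared state, so
  \<open>G2\<close> is exchanged first. This brings \<open>F\<close> next to \<open>G1\<close>,
  which is exchanged second.\<close>

lemma intertwine_comp:
  assumes F: "growth a F" and G1: "growth a' G1" and G2: "growth a' G2"
    and a: "0 \<le> a" "0 \<le> a'" "a * a' < 1"
    and 1: "intertwine F G1 c1" and 2: "intertwine F G2 c2"
  shows "intertwine F (kernel_comp G1 G2) (c1 * c2)"
  unfolding intertwine_def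
proof (intro allI)
  fix lam mu
  define P where "P = {C. G2 C lam \<noteq> 0}"
  define Q where "Q = {C. F C mu \<noteq> 0}"
  have fin: "finite P" "finite Q"
    unfolding P_def Q_def using growth_finite[OF G2] growth_finite[OF F] by auto
  have G2F: "(\<Sum>\<^sub>\<infinity>C. G2 C lam * F C D) = (\<Sum>C\<in>P. G2 C lam * F C D)" for D
  proof -
    have "(\<Sum>\<^sub>\<infinity>C. G2 C lam * F C D) = (\<Sum>\<^sub>\<infinity>C\<in>P. G2 C lam * F C D)"
      by (rule infsum_cong_neutral) (auto simp: P_def)
    then show ?thesis using fin by simp
  qed
  have QF: "(\<Sum>\<^sub>\<infinity>C. G C * F C mu) = (\<Sum>C\<in>Q. G C * F C mu)" for G
  proof -
    have "(\<Sum>\<^sub>\<infinity>C. G C * F C mu) = (\<Sum>\<^sub>\<infinity>C\<in>Q. G C * F C mu)"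
      by (rule infsum_cong_neutral) (auto simp: Q_def)
    then show ?thesis using fin by simp
  qed
  have compP: "kernel_comp G1 G2 D lam = (\<Sum>C\<in>P. G1 D C * G2 C lam)" for D
    unfolding P_def by (rule comp_eq_sum) (rule growth_finite[OF G2])
  have "(\<Sum>\<^sub>\<infinity>C. F lam C * kernel_comp G1 G2 mu C) = (\<Sum>\<^sub>\<infinity>C. \<Sum>\<^sub>\<infinity>D. F lam C * (G1 mu D * G2 D C))"
    by (simp add: kernel_comp_def infsum_cmult_right')
  also have "\<dots> = (\<Sum>\<^sub>\<infinity>D. \<Sum>\<^sub>\<infinity>C. F lam C * (G1 mu D * G2 D C))"
    by (rule infsum_swap_banach) (simp add: summable_growth_triple[OF F G1 G2 a])
  also have "\<dots> = (\<Sum>\<^sub>\<infinity>D. G1 mu D * (\<Sum>\<^sub>\<infinity>C. F lam C * G2 D C))"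
    by (simp add: infsum_cmult_right'[symmetric] mult_ac)
  also have "\<dots> = (\<Sum>\<^sub>\<infinity>D. G1 mu D * (c2 * (\<Sum>C\<in>P. G2 C lam * F C D)))"
    using 2 by (simp add: intertwine_def G2F)
  \<comment> \<open>After the first exchange the sum over \<open>C\<close> is confined to the finite
    set \<open>P\<close>, so the next interchange needs only the summability of each single
    term.\<close>
  also have "\<dots> = (\<Sum>\<^sub>\<infinity>D. \<Sum>C\<in>P. (c2 * G2 C lam) * (F C D * G1 mu D))"
    by (simp add: sum_distrib_left mult_ac)
  also have "\<dots> = (\<Sum>C\<in>P. \<Sum>\<^sub>\<infinity>D. (c2 * G2 C lam) * (F C D * G1 mu D))"
    by (rule infsum_finite_sum) (auto intro!: fin summable_on_cmult_right summable_growth_product[OF F G1 a])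
  also have "\<dots> = (\<Sum>C\<in>P. (c2 * G2 C lam) * (c1 * (\<Sum>D\<in>Q. G1 D C * F D mu)))"
    using 1 by (simp add: infsum_cmult_right' intertwine_def QF)
  also have "\<dots> = c1 * c2 * (\<Sum>C\<in>P. \<Sum>D\<in>Q. G1 D C * G2 C lam * F D mu)"
    by (simp add: sum_distrib_left mult_ac)
  also have "(\<Sum>C\<in>P. \<Sum>D\<in>Q. G1 D C * G2 C lam * F D mu) = (\<Sum>D\<in>Q. kernel_comp G1 G2 D lam * F D mu)"
    unfolding compP sum_distrib_right by (rule sum.swap)
  finally show "(\<Sum>\<^sub>\<infinity>C. F lam C * kernel_comp G1 G2 mu C) = c1 * c2 * (\<Sum>\<^sub>\<infinity>C. kernel_comp G1 G2 C lam * F C mu)"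
    by (simp add: QF)
qed

section \<open>Exchanging all rows\<close>

lemma transfer_kernel_0: "transfer_kernel W b 0 = id_kernel"
  by (intro ext) (simp add: id_kernel_def)

lemma transfer_kernel_Suc:
  "transfer_kernel W b (Suc r) = kernel_comp (transfer_kernel W b r) (row_weight (W (Suc r)) b)"
proof (intro ext)
  fix A B
  have "(\<Sum>\<^sub>\<infinity>C. transfer_kernel W b r A C * row_weight (W (Suc r)) b C B) =
      (\<Sum>\<^sub>\<infinity>C\<in>below b B. transfer_kernel W b r A C * row_weight (W (Suc r)) b C B)"
    by (rule infsum_cong_neutral) (auto simp: below_def row_weight_def)
  then show "transfer_kernel W b (Suc r) A B = kernel_comp (transfer_kernel W b r) (row_weight (W (Suc r)) b) A B"
    by (simp add: kernel_comp_def finite_below)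
qed

lemma growth_transfer:
  assumes "0 \<le> a" "\<And>i. i \<in> {1..r} \<Longrightarrow> growth a (row_weight (W i) b)"
  shows "growth a (transfer_kernel W b r)"
  using assms(2)
proof (induction r)
  case 0
  then show ?case by (simp add: transfer_kernel_0 growth_id assms(1))
next
  case (Suc r)
  then show ?case unfolding transfer_kernel_Suc by (intro growth_comp assms(1)) auto
qed

lemma intertwine_transfer:
  assumes a: "0 \<le> a" "0 \<le> a'" "a * a' < 1"
    and V: "growth a F" and W: "\<And>j. j \<in> {1..N} \<Longrightarrow> growth a' (row_weight (W j) b)"
    and "\<And>j. j \<in> {1..N} \<Longrightarrow> intertwine F (row_weight (W j) b) (c j)"
  shows "intertwine F (transfer_kernel W b N) (\<Prod>j=1..N. c j)"
  using W assms(6)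
proof (induction N)
  case 0
  then show ?case by (simp add: transfer_kernel_0 intertwine_id)
next
  case (Suc N)
  have "intertwine F (kernel_comp (transfer_kernel W b N) (row_weight (W (Suc N)) b)) ((\<Prod>j=1..N. c j) * c (Suc N))"
    using Suc by (intro intertwine_comp[OF V _ _ a] growth_transfer a) auto
  then show ?case by (simp add: transfer_kernel_Suc)
qed

lemma skew_cauchy_transfer:
  fixes q s :: complex and u v :: "nat \<Rightarrow> complex"
  assumes gen: "generic q s"
    and u: "\<And>i. i \<in> {1..M} \<Longrightarrow> 1 - s * u i \<noteq> 0"
    and v: "\<And>j. j \<in> {1..N} \<Longrightarrow> 1 - s * v j \<noteq> 0"
    and uv: "\<And>i j. i \<in> {1..M} \<Longrightarrow> j \<in> {1..N} \<Longrightarrow> 1 - u i * v j \<noteq> 0"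
    and ab: "\<And>i j. i \<in> {1..M} \<Longrightarrow> j \<in> {1..N} \<Longrightarrow>
           norm ((u i - s) / (1 - s * u i) * ((v j - s) / (1 - s * v j))) < 1"
  defines "F \<equiv> transfer_kernel (\<lambda>i. vertex_weight q s (u i)) 1 M"
    and "G \<equiv> transfer_kernel (\<lambda>j. conj_weight q s (v j)) 0 N"
  shows "(\<lambda>C. F lam C * G mu C) summable_on UNIV"
    and "(\<lambda>C. G C lam * F C mu) summable_on UNIV"
    and "(\<Sum>\<^sub>\<infinity>C. F lam C * G mu C) =
      (\<Prod>i=1..M. \<Prod>j=1..N. (1 - q * u i * v j) / (1 - u i * v j)) * (\<Sum>\<^sub>\<infinity>C. G C lam * F C mu)"
proof -
  define x where "x = (\<lambda>i. norm ((u i - s) / (1 - s * u i)))"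
  define y where "y = (\<lambda>j. norm ((v j - s) / (1 - s * v j)))"
  \<comment> \<open>Maxima are attained, so the pairwise conditions give \<open>a * a' < 1\<close>.
    The inserted 0 keeps the sets nonempty and covers \<open>M = 0\<close> and
    \<open>N = 0\<close>.\<close>
  define a where "a = Max (insert 0 (x ` {1..M}))"
  define a' where "a' = Max (insert 0 (y ` {1..N}))"
  have a: "0 \<le> a" "0 \<le> a'" unfolding a_def a'_def by (intro Max_ge; simp)+
  have xa: "x i \<le> a" if "i \<in> {1..M}" for i using that unfolding a_def by (intro Max_ge) auto
  have ya: "y j \<le> a'" if "j \<in> {1..N}" for j using that unfolding a'_def by (intro Max_ge) auto
  have "a \<in> insert 0 (x ` {1..M})" "a' \<in> insert 0 (y ` {1..N})"
    unfolding a_def a'_def by (rule Max_in; simp)+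
  moreover have "x i * y j < 1" if "i \<in> {1..M}" "j \<in> {1..N}" for i j
    using ab[OF that] by (simp only: x_def y_def norm_mult)
  ultimately have aa: "a * a' < 1" by auto
  have gF: "growth a (row_weight (vertex_weight q s (u i)) 1)" if i: "i \<in> {1..M}" for i
  proof (rule growth_row)
    show "norm (vertex_weight q s (u i) 0 1 0 1) \<le> a"
      using xa[OF i] by (simp add: x_def vertex_weight_def)
    show "i1 + j1 = i2 + j2 \<and> j1 < 2 \<and> j2 < 2" if "vertex_weight q s (u i) i1 j1 i2 j2 \<noteq> 0" for i1 j1 i2 j2
      using vertex_weight_conserves[OF that] by blast
  qed (rule vertex_weight_empty[OF u[OF i]])
  have gG: "growth a' (row_weight (conj_weight q s (v j)) 0)" if j: "j \<in> {1..N}" for j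
  proof (rule growth_row)
    show "norm (conj_weight q s (v j) 0 1 0 1) \<le> a'"
      using ya[OF j] by (simp add: y_def conj_weight_eq[OF gen])
    show "i1 + j1 = i2 + j2 \<and> j1 < 2 \<and> j2 < 2" if "conj_weight q s (v j) i1 j1 i2 j2 \<noteq> 0" for i1 j1 i2 j2
      using conj_weight_conserves[OF that] by blast
  qed (rule conj_weight_empty[OF v[OF j]])
  have growth: "growth a F" "growth a' G"
    unfolding F_def G_def by (intro growth_transfer a gF gG; assumption)+
  show "(\<lambda>C. F lam C * G mu C) summable_on UNIV"
    by (rule summable_growth_product[OF growth a aa])
  have "(\<lambda>C. G C lam * F C mu) summable_on {C. F C mu \<noteq> 0}"
    by (rule summable_on_finite) (rule growth_finite[OF growth(1)])
  then show "(\<lambda>C. G C lam * F C mu) summable_on UNIV"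
    by (rule summable_on_cong_neutral[THEN iffD1, rotated -1]) auto
  have one: "intertwine (row_weight (vertex_weight q s (u i)) 1) (row_weight (conj_weight q s (v j)) 0)
      ((1 - q * u i * v j) / (1 - u i * v j))" if "i \<in> {1..M}" "j \<in> {1..N}" for i j
    unfolding intertwine_def
    by (intro allI skew_cauchy_one_variable[OF gen u[OF that(1)] v[OF that(2)] uv[OF that] ab[OF that]]
        summable_growth_product[OF gF[OF that(1)] gG[OF that(2)] a aa])
  \<comment> \<open>All \<open>v\<close>-rows are first moved past a single \<open>u\<close>-row. By
    symmetry the result is an exchange of \<open>G\<close> with that row, and the same composition
    lemma then assembles the \<open>u\<close>-rows.\<close>
  have "intertwine G (row_weight (vertex_weight q s (u i)) 1) (\<Prod>j=1..N. (1 - q * u i * v j) / (1 - u i * v j))"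
    if "i \<in> {1..M}" for i
    unfolding G_def
    by (rule intertwine_sym, rule intertwine_transfer[OF a aa gF[OF that]]) (use gG one[OF that] in auto)
  moreover have "a' * a < 1" using aa by (simp add: mult.commute)
  ultimately have "intertwine G F (\<Prod>i=1..M. \<Prod>j=1..N. (1 - q * u i * v j) / (1 - u i * v j))"
    unfolding F_def by (intro intertwine_transfer[OF a(2,1) _ growth(2)] gF)
  then show "(\<Sum>\<^sub>\<infinity>C. F lam C * G mu C) =
      (\<Prod>i=1..M. \<Prod>j=1..N. (1 - q * u i * v j) / (1 - u i * v j)) * (\<Sum>\<^sub>\<infinity>C. G C lam * F C mu)"
    using intertwine_sym[of G F] unfolding intertwine_def by blast
qed

section \<open>Collections of paths\<close>

definition vedge :: "nat \<Rightarrow> int \<Rightarrow> edge" where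
  "vedge x y = ((int x, y), (int x, y + 1))"

definition hedge :: "int \<Rightarrow> int \<Rightarrow> edge" where
  "hedge x y = ((x - 1, y), (x, y))"

text \<open>The multiplicity \<open>b\<close> treats both functions at once: \<open>b = 1\<close>
  gives the left boundary of F and \<open>b = 0\<close> that of G.\<close>

definition start_edges :: "nat \<Rightarrow> nat \<Rightarrow> nat multiset \<Rightarrow> edge multiset" where
  "start_edges b r A = image_mset (\<lambda>x. vedge x 0) A + repeat_mset b (left_edges r)"

definition end_edges :: "nat \<Rightarrow> nat multiset \<Rightarrow> edge multiset" where
  "end_edges r B = image_mset (\<lambda>x. vedge x (int r)) B"

lemma size_filter_eq_sum: "size {#x \<in># M. P x#} = (\<Sum>x\<in>#M. of_bool (P x))"
  by (induction M) auto

lemma num_through_eq_sum: "num_through C e = (\<Sum>p\<in>#C. of_bool (e \<in> set (edges p)))"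
  by (simp add: num_through_def size_filter_eq_sum)

lemma num_through_pos_iff: "0 < num_through C e \<longleftrightarrow> (\<exists>p\<in>#C. e \<in> set (edges p))"
  by (auto simp: num_through_def nonempty_has_size[symmetric] filter_mset_eq_conv)

lemma mem_edges_iff: "e \<in> set (edges p) \<longleftrightarrow> (\<exists>i. Suc i < length p \<and> e = (p ! i, p ! Suc i))"
  by (cases e) (auto simp: edges_def in_set_zip nth_tl less_diff_conv)

lemma successively_nth: "successively P p \<Longrightarrow> Suc i < length p \<Longrightarrow> P (p ! i) (p ! Suc i)"
proof (induction p arbitrary: i)
  case (Cons a p)
  then show ?case by (cases i) (auto simp: successively_Cons hd_conv_nth)
qed simp

lemma path_step: "up_right_path p \<Longrightarrow> Suc i < length p \<Longrightarrow> unit_step (p ! i) (p ! Suc i)"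
  using successively_nth[of unit_step p i] by (simp add: up_right_path_def)

text \<open>The sum of the coordinates grows by one at each step, so a path visits a vertex at most
  once.\<close>

lemma path_height:
  assumes "up_right_path p" "i < length p"
  shows "fst (p ! i) + snd (p ! i) = fst (p ! 0) + snd (p ! 0) + int i"
  using assms(2)
proof (induction i)
  case (Suc i)
  have "unit_step (p ! i) (p ! Suc i)"
    using path_step[OF assms(1) Suc.prems] .
  then show ?case using Suc by (auto simp: unit_step_def)
qed simp

lemma path_mono:
  assumes "up_right_path p" "i \<le> j" "j < length p"
  shows "fst (p ! i) \<le> fst (p ! j)" "snd (p ! i) \<le> snd (p ! j)"
proof -
  have "fst (p ! i) \<le> fst (p ! j) \<and> snd (p ! i) \<le> snd (p ! j)"
    using assms(2,3)
  proof (induction j rule: dec_induct)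
    case (step j)
    have "unit_step (p ! j) (p ! Suc j)"
      using path_step[OF assms(1) step.prems] .
    then have "fst (p ! j) \<le> fst (p ! Suc j) \<and> snd (p ! j) \<le> snd (p ! Suc j)"
      by (auto simp: unit_step_def)
    moreover have "fst (p ! i) \<le> fst (p ! j) \<and> snd (p ! i) \<le> snd (p ! j)"
      using step.IH step.prems by simp
    ultimately show ?case by linarith
  qed simp
  then show "fst (p ! i) \<le> fst (p ! j)" "snd (p ! i) \<le> snd (p ! j)" by auto
qed

lemma path_distinct:
  assumes "up_right_path p" "i < length p" "j < length p" "p ! i = p ! j"
  shows "i = j"
proof -
  have "int i = int j"
    using path_height[OF assms(1,2)] path_height[OF assms(1,3)] unfolding assms(4) by linarith
  then show ?thesis by simp
qed

lemma path_hd_last: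
  assumes "up_right_path p"
  shows "hd p = p ! 0" "last p = p ! (length p - 1)"
    "hd (edges p) = (p ! 0, p ! 1)" "last (edges p) = (p ! (length p - 2), p ! (length p - 1))"
proof -
  have l: "2 \<le> length p" using assms by (simp add: up_right_path_def)
  have len: "length (edges p) = length p - 1" by (simp add: edges_def)
  have nth: "edges p ! i = (p ! i, p ! Suc i)" if "Suc i < length p" for i
    using that by (simp add: edges_def nth_tl)
  have ne: "p \<noteq> []" "edges p \<noteq> []" using l len by auto
  show "hd p = p ! 0" "last p = p ! (length p - 1)"
    using ne by (simp_all add: hd_conv_nth last_conv_nth)
  show "hd (edges p) = (p ! 0, p ! 1)"
    using ne l nth[of 0] by (simp add: hd_conv_nth)
  have "Suc (length p - 2) = length p - 1" "length (edges p) - 1 = length p - 2" using l len by simp_all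
  then show "last (edges p) = (p ! (length p - 2), p ! (length p - 1))"
    using l nth[of "length p - 2"] unfolding last_conv_nth[OF ne(2)] by simp
qed

text \<open>A path passes a vertex at most once, so away from its ends it uses exactly one incoming
  and one outgoing edge at each of its vertices.\<close>

lemma path_conserves:
  assumes p: "up_right_path p" and z: "(x, y) \<noteq> hd p" "(x, y) \<noteq> last p"
  shows "of_bool (((x - 1, y), (x, y)) \<in> set (edges p)) + of_bool (((x, y - 1), (x, y)) \<in> set (edges p)) =
      (of_bool ((x, y) \<in> set p) :: nat)"
    and "of_bool (((x, y), (x, y + 1)) \<in> set (edges p)) + of_bool (((x, y), (x + 1, y)) \<in> set (edges p)) =
      (of_bool ((x, y) \<in> set p) :: nat)"
proof -
  have notin: "(w, (x, y)) \<notin> set (edges p)" "((x, y), w) \<notin> set (edges p)" if "(x, y) \<notin> set p" for w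
  proof -
    have "(x, y) \<noteq> p ! i" if "i < length p" for i
      using nth_mem[OF that] \<open>(x, y) \<notin> set p\<close> by auto
    then show "(w, (x, y)) \<notin> set (edges p)" "((x, y), w) \<notin> set (edges p)"
      unfolding mem_edges_iff prod.inject using Suc_lessD by blast+
  qed
  show "of_bool (((x - 1, y), (x, y)) \<in> set (edges p)) + of_bool (((x, y - 1), (x, y)) \<in> set (edges p)) =
      (of_bool ((x, y) \<in> set p) :: nat)"
  proof (cases "(x, y) \<in> set p")
    case True
    then obtain j where j: "j < length p" "p ! j = (x, y)" by (auto simp: in_set_conv_nth)
    then obtain i where i: "j = Suc i" using z(1) path_hd_last[OF p] by (cases j) auto
    have inc: "(w, (x, y)) \<in> set (edges p) \<longleftrightarrow> w = p ! i" for w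
    proof
      assume "(w, (x, y)) \<in> set (edges p)"
      then obtain k where k: "Suc k < length p" "w = p ! k" "(x, y) = p ! Suc k" by (auto simp: mem_edges_iff)
      then have "Suc k = j" using path_distinct[OF p, of "Suc k" j] j by simp
      then show "w = p ! i" using k i by simp
    next
      assume "w = p ! i"
      then show "(w, (x, y)) \<in> set (edges p)"
        unfolding mem_edges_iff using i j by (intro exI[of _ i]) simp
    qed
    have "p ! i = (x - 1, y) \<or> p ! i = (x, y - 1)"
    proof -
      have "unit_step (p ! i) (x, y)" using path_step[OF p, of i] i j by simp
      then show ?thesis by (cases "p ! i") (auto simp: unit_step_def)
    qed
    then show ?thesis using True unfolding inc by (elim disjE) simp_all
  qed (use notin in auto)
  show "of_bool (((x, y), (x, y + 1)) \<in> set (edges p)) + of_bool (((x, y), (x + 1, y)) \<in> set (edges p)) =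
      (of_bool ((x, y) \<in> set p) :: nat)"
  proof (cases "(x, y) \<in> set p")
    case True
    then obtain j where j: "j < length p" "p ! j = (x, y)" by (auto simp: in_set_conv_nth)
    have j1: "Suc j < length p"
    proof (rule ccontr)
      assume "\<not> ?thesis"
      then have "j = length p - 1" using j by simp
      then show False using z(2) j path_hd_last[OF p] by simp
    qed
    have out: "((x, y), w) \<in> set (edges p) \<longleftrightarrow> w = p ! Suc j" for w
    proof
      assume "((x, y), w) \<in> set (edges p)"
      then obtain k where k: "Suc k < length p" "w = p ! Suc k" "(x, y) = p ! k" by (auto simp: mem_edges_iff)
      then have "k = j" using path_distinct[OF p, of k j] j by simp
      then show "w = p ! Suc j" using k by simp
    next
      assume "w = p ! Suc j"
      then show "((x, y), w) \<in> set (edges p)"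
        unfolding mem_edges_iff using j j1 by (intro exI[of _ j]) simp
    qed
    have "p ! Suc j = (x, y + 1) \<or> p ! Suc j = (x + 1, y)"
    proof -
      have "unit_step (x, y) (p ! Suc j)" using path_step[OF p j1] j by simp
      then show ?thesis by (auto simp: unit_step_def)
    qed
    then show ?thesis using True unfolding out by (elim disjE) simp_all
  qed (use notin in auto)
qed

text \<open>Applied to boundary edges, which a path can use only as its first or only as its last
  edge, so their numbers are the prescribed multiplicities.\<close>

lemma num_through_eq_count:
  assumes "image_mset f C = E" "\<And>p. p \<in># C \<Longrightarrow> e \<in> set (edges p) \<longleftrightarrow> f p = e"
  shows "num_through C e = count E e"
proof -
  have "num_through C e = size {#p \<in># C. f p = e#}"
    unfolding num_through_def using assms(2) by (intro arg_cong[of _ _ size] filter_mset_cong) auto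
  also have "\<dots> = count (image_mset f C) e" by (induction C) auto
  finally show ?thesis using assms(1) by simp
qed

lemma count_vedges: "count (image_mset (\<lambda>x. vedge x y) A) (vedge z y) = count A z"
proof (induction A)
  case (add a A)
  then show ?case by (auto simp: vedge_def)
qed simp

lemma count_left_edges: "count (left_edges r) e = (if \<exists>j\<in>{1..r}. e = hedge 0 (int j) then 1 else 0)"
proof -
  have *: "left_edges r = mset_set ((\<lambda>j. hedge 0 (int j)) ` {1..r})"
    unfolding left_edges_def by (subst image_mset_mset_set) (auto simp: inj_on_def hedge_def)
  show ?thesis unfolding * by (auto simp: count_mset_set')
qed

text \<open>The two ends of a path lie just outside the strip \<open>0 \<le> x\<close>,
  \<open>1 \<le> y \<le> r\<close>, and all its other vertices lie inside. An end of one path is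
  therefore never interior to another.\<close>

lemma collection_path:
  assumes C: "C \<in> collections (start_edges b r A) (end_edges r B)" and p: "p \<in># C"
  shows "up_right_path p"
    "snd (p ! 0) = 0 \<or> fst (p ! 0) = -1"
    "\<And>i. 1 \<le> i \<Longrightarrow> i < length p \<Longrightarrow> fst (p ! i) \<ge> 0 \<and> snd (p ! i) \<ge> 1"
    "\<And>i. Suc i < length p \<Longrightarrow> snd (p ! i) \<le> int r"
    "snd (p ! (length p - 1)) = int r + 1"
proof -
  show path: "up_right_path p" using C p by (auto simp: collections_def)
  then have l: "2 \<le> length p" by (simp add: up_right_path_def)
  have "image_mset (\<lambda>p. hd (edges p)) C = start_edges b r A" "image_mset (\<lambda>p. last (edges p)) C = end_edges r B"
    using C by (simp_all add: collections_def)
  then have "hd (edges p) \<in># start_edges b r A" "last (edges p) \<in># end_edges r B"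
    using p by (metis image_eqI set_image_mset)+
  then have first: "(p ! 0, p ! 1) \<in># start_edges b r A"
    and last: "(p ! (length p - 2), p ! (length p - 1)) \<in># end_edges r B"
    using path_hd_last[OF path] by simp_all
  have "(p ! 0, p ! 1) \<in># left_edges r" if "(p ! 0, p ! 1) \<in># repeat_mset b (left_edges r)"
    using that by (metis count_repeat_mset mult_0_right not_in_iff)
  with first have "(\<exists>x. (p ! 0, p ! 1) = vedge x 0) \<or> (p ! 0, p ! 1) \<in># left_edges r"
    by (auto simp: start_edges_def)
  then have 0: "(snd (p ! 0) = 0 \<or> fst (p ! 0) = -1) \<and> fst (p ! 1) \<ge> 0 \<and> snd (p ! 1) \<ge> 1"
  proof
    assume "(p ! 0, p ! 1) \<in># left_edges r"
    then have "count (left_edges r) (p ! 0, p ! 1) \<noteq> 0" by (simp add: count_eq_zero_iff)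
    then obtain j where "j \<in> {1..r}" "(p ! 0, p ! 1) = hedge 0 (int j)"
      unfolding count_left_edges by metis
    then show ?thesis by (auto simp: hedge_def)
  qed (auto simp: vedge_def)
  then show "snd (p ! 0) = 0 \<or> fst (p ! 0) = -1" by simp
  show "fst (p ! i) \<ge> 0 \<and> snd (p ! i) \<ge> 1" if "1 \<le> i" "i < length p" for i
    using path_mono[OF path that] 0 by simp
  from last have "snd (p ! (length p - 2)) = int r \<and> snd (p ! (length p - 1)) = int r + 1"
    by (auto simp: end_edges_def vedge_def)
  then show "snd (p ! (length p - 1)) = int r + 1"
    and "\<And>i. Suc i < length p \<Longrightarrow> snd (p ! i) \<le> int r"
    using path_mono(2)[OF path, of _ "length p - 2"] l by force+
qed

lemma not_hd_last:
  assumes "C \<in> collections (start_edges b r A) (end_edges r B)"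
    and "p \<in># C" "0 \<le> x" "1 \<le> y" "y \<le> int r"
  shows "(x, y) \<noteq> hd p" "(x, y) \<noteq> last p"
proof -
  note c = collection_path[OF assms(1,2)]
  show "(x, y) \<noteq> hd p" using c(2) path_hd_last(1)[OF c(1)] assms by (cases "p ! 0") auto
  show "(x, y) \<noteq> last p" using c(5) path_hd_last(2)[OF c(1)] assms by (cases "p ! (length p - 1)") auto
qed

section \<open>The states of a collection between its rows\<close>

definition vstate :: "vertex list multiset \<Rightarrow> nat \<Rightarrow> nat multiset" where
  "vstate C y = Abs_multiset (\<lambda>x. num_through C (vedge x (int y)))"

text \<open>A vertex touched by no path has all four numbers equal to \<open>0\<close> and is not an interior vertex,
  hence the value \<open>None\<close> there.\<close>

definition config :: "nat \<Rightarrow> nat \<Rightarrow> (nat \<Rightarrow> nat multiset) \<Rightarrow> vertex \<rightharpoonup> nat \<times> nat \<times> nat \<times> nat" where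
  "config b r c = (\<lambda>(x, y). let
      A = c (nat (y - 1)); B = c (nat y);
      d = (count A (nat x), flux b A B (nat x), count B (nat x), flux b A B (Suc (nat x)))
    in if 0 \<le> x \<and> 1 \<le> y \<and> y \<le> int r \<and> d \<noteq> (0, 0, 0, 0) then Some d else None)"

text \<open>The default \<open>{#}\<close> above \<open>r\<close> makes a sequence determined by its
  values up to \<open>r\<close>, so that counting sequences is counting configurations.\<close>

definition state_seqs :: "nat \<Rightarrow> nat \<Rightarrow> nat multiset \<Rightarrow> nat multiset \<Rightarrow> (nat \<Rightarrow> nat multiset) set" where
  "state_seqs b r A B = {c. c 0 = A \<and> c r = B \<and> (\<forall>y<r. admissible b (c y) (c (Suc y))) \<and> (\<forall>y>r. c y = {#})}"

lemma finite_vertices: "\<exists>X. \<forall>p\<in>#C. \<forall>v\<in>set p. fst v < int X"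
proof -
  have "finite (fst ` (\<Union>p\<in>set_mset C. set p))" by simp
  then obtain m where "\<And>v. v \<in> fst ` (\<Union>p\<in>set_mset C. set p) \<Longrightarrow> v \<le> m"
    using finite_nat_set_iff_bounded_le by (metis bdd_above_finite bdd_above_def)
  then have "\<forall>p\<in>#C. \<forall>v\<in>set p. fst v < int (nat (m + 1))" by force
  then show ?thesis by blast
qed

lemma edge_vertices: "(v, w) \<in> set (edges p) \<Longrightarrow> v \<in> set p \<and> w \<in> set p"
  using nth_mem[of _ p] unfolding mem_edges_iff by (auto simp: Suc_lessD)

lemma count_vstate: "count (vstate C y) x = num_through C (vedge x (int y))"
proof -
  obtain X where X: "\<forall>p\<in>#C. \<forall>v\<in>set p. fst v < int X" using finite_vertices by blast
  have "{x. 0 < num_through C (vedge x (int y))} \<subseteq> {..<X}"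
  proof
    fix x assume "x \<in> {x. 0 < num_through C (vedge x (int y))}"
    then obtain p where "p \<in># C" "vedge x (int y) \<in> set (edges p)" by (auto simp: num_through_pos_iff)
    then have "(int x, int y) \<in> set p" using edge_vertices by (auto simp: vedge_def)
    then show "x \<in> {..<X}" using X \<open>p \<in># C\<close> by force
  qed
  then have "finite {x. 0 < num_through C (vedge x (int y))}" by (rule finite_subset) simp
  then show ?thesis by (simp add: vstate_def count_Abs_multiset)
qed

context
  fixes b r :: nat and A B :: "nat multiset" and C :: "vertex list multiset"
  assumes C: "C \<in> collections (start_edges b r A) (end_edges r B)"
begin

lemma num_through_conserves:
  assumes "0 \<le> x" "1 \<le> y" "y \<le> int r"
  shows "num_through C ((x - 1, y), (x, y)) + num_through C ((x, y - 1), (x, y)) =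
    num_through C ((x, y), (x, y + 1)) + num_through C ((x, y), (x + 1, y))"
proof -
  have "num_through C ((x - 1, y), (x, y)) + num_through C ((x, y - 1), (x, y)) = (\<Sum>p\<in>#C. of_bool ((x, y) \<in> set p))"
    unfolding num_through_eq_sum sum_mset.distrib[symmetric]
    using path_conserves(1)[OF collection_path(1)[OF C] not_hd_last[OF C _ assms]]
    by (intro arg_cong[of _ _ sum_mset] image_mset_cong) simp
  also have "\<dots> = num_through C ((x, y), (x, y + 1)) + num_through C ((x, y), (x + 1, y))"
    unfolding num_through_eq_sum sum_mset.distrib[symmetric]
    using path_conserves(2)[OF collection_path(1)[OF C] not_hd_last[OF C _ assms]]
    by (intro arg_cong[of _ _ sum_mset] image_mset_cong) simp
  finally show ?thesis .
qed

lemma vstate_0: "vstate C 0 = A"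
proof (rule multiset_eqI)
  fix x
  have "num_through C (vedge x 0) = count (start_edges b r A) (vedge x 0)"
  proof (rule num_through_eq_count)
    show "image_mset (\<lambda>p. hd (edges p)) C = start_edges b r A" using C by (simp add: collections_def)
    fix p assume p: "p \<in># C"
    note c = collection_path[OF C p]
    show "vedge x 0 \<in> set (edges p) \<longleftrightarrow> hd (edges p) = vedge x 0"
    proof
      assume "vedge x 0 \<in> set (edges p)"
      then obtain i where i: "Suc i < length p" "vedge x 0 = (p ! i, p ! Suc i)" by (auto simp: mem_edges_iff)
      then have "snd (p ! i) = 0" using i(2)[symmetric] by (simp add: vedge_def)
      then have "i = 0" using c(3)[of i] i(1) by (cases "i = 0") auto
      then show "hd (edges p) = vedge x 0" using i path_hd_last(3)[OF c(1)] by simp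
    next
      assume "hd (edges p) = vedge x 0"
      then show "vedge x 0 \<in> set (edges p)"
        using c(1) path_hd_last(3)[OF c(1)] unfolding mem_edges_iff up_right_path_def by (intro exI[of _ 0]) auto
    qed
  qed
  also have "\<dots> = count A x"
  proof -
    have "\<not> (\<exists>j\<in>{1..r}. vedge x 0 = hedge 0 (int j))" by (auto simp: vedge_def hedge_def)
    then show ?thesis by (simp add: start_edges_def count_vedges count_left_edges)
  qed
  finally show "count (vstate C 0) x = count A x" by (simp add: count_vstate)
qed

lemma vstate_top: "vstate C r = B"
proof (rule multiset_eqI)
  fix x
  have "num_through C (vedge x (int r)) = count (end_edges r B) (vedge x (int r))"
  proof (rule num_through_eq_count)
    show "image_mset (\<lambda>p. last (edges p)) C = end_edges r B" using C by (simp add: collections_def)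
    fix p assume p: "p \<in># C"
    note c = collection_path[OF C p]
    have l: "2 \<le> length p" using c(1) by (simp add: up_right_path_def)
    then have l1: "Suc (length p - 2) = length p - 1" by simp
    show "vedge x (int r) \<in> set (edges p) \<longleftrightarrow> last (edges p) = vedge x (int r)"
    proof
      assume "vedge x (int r) \<in> set (edges p)"
      then obtain i where i: "Suc i < length p" "vedge x (int r) = (p ! i, p ! Suc i)" by (auto simp: mem_edges_iff)
      then have "snd (p ! Suc i) = int r + 1" using i(2)[symmetric] by (simp add: vedge_def)
      then have "\<not> Suc (Suc i) < length p" using c(4)[of "Suc i"] by auto
      then have "i = length p - 2" using i(1) by simp
      then show "last (edges p) = vedge x (int r)" using i l1 path_hd_last(4)[OF c(1)] by simp
    next
      assume "last (edges p) = vedge x (int r)"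
      then show "vedge x (int r) \<in> set (edges p)"
        using l l1 path_hd_last(4)[OF c(1)] unfolding mem_edges_iff by (intro exI[of _ "length p - 2"]) auto
    qed
  qed
  then show "count (vstate C r) x = count B x" by (simp add: count_vstate end_edges_def count_vedges)
qed

lemma num_through_left:
  assumes "1 \<le> y" "y \<le> r"
  shows "num_through C (hedge 0 (int y)) = b"
proof -
  have "num_through C (hedge 0 (int y)) = count (start_edges b r A) (hedge 0 (int y))"
  proof (rule num_through_eq_count)
    show "image_mset (\<lambda>p. hd (edges p)) C = start_edges b r A" using C by (simp add: collections_def)
    fix p assume p: "p \<in># C"
    note c = collection_path[OF C p]
    show "hedge 0 (int y) \<in> set (edges p) \<longleftrightarrow> hd (edges p) = hedge 0 (int y)"
    proof
      assume "hedge 0 (int y) \<in> set (edges p)"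
      then obtain i where i: "Suc i < length p" "hedge 0 (int y) = (p ! i, p ! Suc i)" by (auto simp: mem_edges_iff)
      then have "fst (p ! i) = -1" using i(2)[symmetric] by (simp add: hedge_def)
      then have "i = 0" using c(3)[of i] i(1) by (cases "i = 0") auto
      then show "hd (edges p) = hedge 0 (int y)" using i path_hd_last(3)[OF c(1)] by simp
    next
      assume "hd (edges p) = hedge 0 (int y)"
      then show "hedge 0 (int y) \<in> set (edges p)"
        using c(1) path_hd_last(3)[OF c(1)] unfolding mem_edges_iff up_right_path_def by (intro exI[of _ 0]) auto
    qed
  qed
  also have "count (image_mset (\<lambda>x. vedge x 0) A) (hedge 0 (int y)) = 0"
    by (auto simp: count_eq_zero_iff vedge_def hedge_def)
  then have "count (start_edges b r A) (hedge 0 (int y)) = b"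
    using assms by (auto simp: start_edges_def count_left_edges)
  finally show ?thesis .
qed

text \<open>Conservation, summed over the columns left of \<open>x\<close>, expresses a horizontal
  number through the vertical ones. The additive form avoids truncated subtraction.\<close>

lemma num_through_hedge:
  assumes "y < r"
  shows "num_through C (hedge (int x) (int (Suc y))) + lt_count (vstate C (Suc y)) x = b + lt_count (vstate C y) x"
proof (induction x)
  case 0
  then show ?case using num_through_left[of "Suc y"] assms by simp
next
  case (Suc x)
  have "num_through C (hedge (int x) (int (Suc y))) + count (vstate C y) x =
     count (vstate C (Suc y)) x + num_through C (hedge (int (Suc x)) (int (Suc y)))"
    using num_through_conserves[of "int x" "int (Suc y)"] assms
    by (simp add: count_vstate vedge_def hedge_def add.commute)
  then show ?case using Suc by (simp add: lt_count_Suc)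
qed

lemma flux_vstate:
  assumes "y < r"
  shows "flux b (vstate C y) (vstate C (Suc y)) x = num_through C (hedge (int x) (int (Suc y)))"
  using num_through_hedge[OF assms, of x] by (simp add: flux_def)

lemma admissible_vstate:
  assumes "y < r"
  shows "admissible b (vstate C y) (vstate C (Suc y))"
  unfolding admissible_def
proof (intro conjI allI)
  show "lt_count (vstate C (Suc y)) x \<le> b + lt_count (vstate C y) x" for x
    using num_through_hedge[OF assms, of x] by simp
  \<comment> \<open>Beyond column \<open>X\<close> there are no paths, so there the flux relation
    becomes the equality of sizes.\<close>
  obtain X where X: "\<forall>p\<in>#C. \<forall>v\<in>set p. fst v < int X" using finite_vertices by blast
  have "set_mset (vstate C z) \<subseteq> {..<X}" for z
  proof
    fix x assume "x \<in># vstate C z"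
    then have "0 < num_through C (vedge x (int z))"
      using count_vstate[of C z x] by (metis count_greater_zero_iff)
    then obtain p where "p \<in># C" "vedge x (int z) \<in> set (edges p)" by (auto simp: num_through_pos_iff)
    then have "(int x, int z) \<in> set p" using edge_vertices by (auto simp: vedge_def)
    then show "x \<in> {..<X}" using X \<open>p \<in># C\<close> by force
  qed
  then have "lt_count (vstate C z) X = size (vstate C z)" for z
    by (simp add: lt_count_eq_size_iff)
  moreover have "num_through C (hedge (int X) (int (Suc y))) = 0"
  proof (rule ccontr)
    assume "num_through C (hedge (int X) (int (Suc y))) \<noteq> 0"
    then obtain p where "p \<in># C" "hedge (int X) (int (Suc y)) \<in> set (edges p)"
      using num_through_pos_iff by blast
    then have "(int X, int (Suc y)) \<in> set p" using edge_vertices unfolding hedge_def by blast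
    then show False using X \<open>p \<in># C\<close> by force
  qed
  ultimately show "size (vstate C (Suc y)) = size (vstate C y) + b"
    using num_through_hedge[OF assms, of X] by simp
qed

lemma interior_iff:
  "(x, y) \<in> interior_vertices C \<longleftrightarrow> 0 \<le> x \<and> 1 \<le> y \<and> y \<le> int r \<and> (\<exists>p\<in>#C. (x, y) \<in> set p)"
proof
  assume "(x, y) \<in> interior_vertices C"
  then obtain p where p: "p \<in># C" "(x, y) \<in> set p" "(x, y) \<noteq> hd p" "(x, y) \<noteq> last p"
    by (auto simp: interior_vertices_def)
  note c = collection_path[OF C p(1)]
  obtain i where i: "i < length p" "p ! i = (x, y)" using p(2) by (auto simp: in_set_conv_nth)
  have "1 \<le> i" using i p(3) path_hd_last(1)[OF c(1)] by (cases i) auto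
  moreover have "i \<noteq> length p - 1" using i p(4) path_hd_last(2)[OF c(1)] by auto
  then have "Suc i < length p" using i(1) by simp
  ultimately show "0 \<le> x \<and> 1 \<le> y \<and> y \<le> int r \<and> (\<exists>p\<in>#C. (x, y) \<in> set p)"
    using c(3)[of i] c(4)[of i] i p by auto
next
  assume "0 \<le> x \<and> 1 \<le> y \<and> y \<le> int r \<and> (\<exists>p\<in>#C. (x, y) \<in> set p)"
  then show "(x, y) \<in> interior_vertices C"
    using not_hd_last[OF C] by (auto simp: interior_vertices_def)
qed

text \<open>The vertical numbers determine all the rest: horizontal numbers are fluxes, and a vertex
  of the strip is interior exactly when its four numbers are not all 0.\<close>

lemma local_data_eq_config: "local_data C = config b r (vstate C)"
proof (intro ext, clarify)
  fix x y :: int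
  show "local_data C (x, y) = config b r (vstate C) (x, y)"
  proof (cases "0 \<le> x \<and> 1 \<le> y \<and> y \<le> int r")
    case False
    then show ?thesis by (auto simp: local_data_def config_def interior_iff Let_def)
  next
    case True
    define z where "z = nat (y - 1)"
    have z: "z < r" "y = int (Suc z)" "nat y = Suc z" "y - 1 = int z" using True by (auto simp: z_def)
    have v: "count (vstate C z) (nat x) = num_through C ((x, y - 1), (x, y))"
      "count (vstate C (Suc z)) (nat x) = num_through C ((x, y), (x, y + 1))"
      unfolding count_vstate vedge_def z(2)[symmetric] z(4)[symmetric] using True by simp_all
    have h: "flux b (vstate C z) (vstate C (Suc z)) (nat x) = num_through C ((x - 1, y), (x, y))"
      "flux b (vstate C z) (vstate C (Suc z)) (Suc (nat x)) = num_through C ((x, y), (x + 1, y))"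
      unfolding flux_vstate[OF z(1)] hedge_def z(2)[symmetric] using True by (simp_all add: add.commute)
    have "(\<exists>p\<in>#C. (x, y) \<in> set p) \<longleftrightarrow>
      num_through C ((x, y - 1), (x, y)) + num_through C ((x - 1, y), (x, y)) \<noteq> 0 \<or>
      num_through C ((x, y), (x, y + 1)) + num_through C ((x, y), (x + 1, y)) \<noteq> 0" (is "?L \<longleftrightarrow> ?R")
    proof
      assume ?L
      then obtain p where p: "p \<in># C" "(x, y) \<in> set p" by blast
      have "((x - 1, y), (x, y)) \<in> set (edges p) \<or> ((x, y - 1), (x, y)) \<in> set (edges p)"
        using path_conserves(1)[OF collection_path(1)[OF C p(1)] not_hd_last[OF C p(1), of x y]] p True
        by (auto simp: of_bool_def split: if_splits)
      then have "0 < num_through C ((x - 1, y), (x, y)) \<or> 0 < num_through C ((x, y - 1), (x, y))"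
        unfolding num_through_pos_iff using p(1) by blast
      then show ?R by auto
    next
      assume ?R
      then have "\<exists>e\<in>{((x, y - 1), (x, y)), ((x - 1, y), (x, y)), ((x, y), (x, y + 1)), ((x, y), (x + 1, y))}.
          0 < num_through C e" by auto
      then show ?L unfolding num_through_pos_iff using edge_vertices by blast
    qed
    then have "(x, y) \<in> interior_vertices C \<longleftrightarrow>
      (num_through C ((x, y - 1), (x, y)), num_through C ((x - 1, y), (x, y)),
       num_through C ((x, y), (x, y + 1)), num_through C ((x, y), (x + 1, y))) \<noteq> (0, 0, 0, 0)"
      using True by (auto simp: interior_iff)
    moreover have "config b r (vstate C) (x, y) = (if
      (num_through C ((x, y - 1), (x, y)), num_through C ((x - 1, y), (x, y)),
       num_through C ((x, y), (x, y + 1)), num_through C ((x, y), (x + 1, y))) \<noteq> (0, 0, 0, 0) then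
      Some (num_through C ((x, y - 1), (x, y)), num_through C ((x - 1, y), (x, y)),
       num_through C ((x, y), (x, y + 1)), num_through C ((x, y), (x + 1, y))) else None)"
      unfolding config_def Let_def prod.case z(3) z_def[symmetric] v h using True by simp
    ultimately show ?thesis by (simp add: local_data_def)
  qed
qed

end

lemma config_cong:
  assumes "\<And>y. y \<le> r \<Longrightarrow> c y = c' y"
  shows "config b r c = config b r c'"
proof (intro ext, clarify)
  fix x y :: int
  show "config b r c (x, y) = config b r c' (x, y)"
  proof (cases "1 \<le> y \<and> y \<le> int r")
    case True
    then have "c (nat y) = c' (nat y)" "c (nat (y - 1)) = c' (nat (y - 1))" using assms by auto
    then show ?thesis by (simp add: config_def)
  next
    case False
    then have "config b r c (x, y) = None" "config b r c' (x, y) = None"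
      unfolding config_def prod.case Let_def by auto
    then show ?thesis by simp
  qed
qed

text \<open>The third entry at a vertex is the multiplicity in the state above it, where
  \<open>None\<close> has to be read as 0. The lowest state is prescribed.\<close>

lemma inj_config: "inj_on (config b r) (state_seqs b r A B)"
proof (rule inj_onI)
  fix c c' assume c: "c \<in> state_seqs b r A B" "c' \<in> state_seqs b r A B" and eq: "config b r c = config b r c'"
  define g where "g = (\<lambda>d :: (nat \<times> nat \<times> nat \<times> nat) option. case d of None \<Rightarrow> 0 | Some (i1, j1, i2, j2) \<Rightarrow> i2)"
  have g: "g (config b r c (int x, int y)) = count (c y) x" if "1 \<le> y" "y \<le> r" for c x y
    using that by (auto simp: config_def Let_def g_def count_eq_zero_iff)
  have "c y = c' y" for y
  proof (cases "1 \<le> y \<and> y \<le> r")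
    case True
    then show ?thesis using g[of y c] g[of y c'] eq by (intro multiset_eqI) metis
  next
    case False
    then have "y = 0 \<or> y > r" by auto
    then show ?thesis using c by (auto simp: state_seqs_def)
  qed
  then show "c = c'" by (rule ext)
qed

section \<open>Realising a sequence of states by paths\<close>

lemma monotone_matching:
  fixes f :: "'a \<Rightarrow> nat"
  assumes "size C = size B" "\<And>x. lt_count B x \<le> lt_count (image_mset f C) x"
  shows "\<exists>P. image_mset fst P = C \<and> image_mset snd P = B \<and> (\<forall>(c, b)\<in>#P. f c \<le> b)"
  using assms
proof (induction "size B" arbitrary: B C)
  case 0
  then show ?case by (intro exI[of _ "{#}"]) auto
next
  case (Suc n)
  \<comment> \<open>Greedy choice: an element of \<open>C\<close> with the largest label is matched
    with the largest entry of \<open>B\<close>. The counting condition at \<open>Suc b\<close> shows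
    that no label exceeds \<open>b\<close>.\<close>
  define b where "b = Max_mset B"
  have "B \<noteq> {#}" "C \<noteq> {#}" using Suc by auto
  have b: "b \<in># B" "\<And>x. x \<in># B \<Longrightarrow> x \<le> b"
    using \<open>B \<noteq> {#}\<close> by (auto simp: b_def)
  have "Max (f ` set_mset C) \<in> f ` set_mset C" using \<open>C \<noteq> {#}\<close> by (intro Max_in) auto
  then obtain c where c: "c \<in># C" "f c = Max (f ` set_mset C)" by auto
  have fc: "f x \<le> f c" if "x \<in># C" for x using that c by simp
  have B: "B = add_mset b (B - {#b#})" and C: "C = add_mset c (C - {#c#})" using b c by simp_all
  have "lt_count B (Suc b) = size B" using b(2) by (auto simp: lt_count_eq_size_iff less_Suc_eq_le)
  then have "lt_count (image_mset f C) (Suc b) = size (image_mset f C)"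
    using Suc.prems(1) Suc.prems(2)[of "Suc b"] lt_count_le_size[of "image_mset f C" "Suc b"] by simp
  then have cb: "f c \<le> b" using c(1) unfolding lt_count_eq_size_iff by (auto simp: less_Suc_eq_le)
  \<comment> \<open>The counting condition survives the removal: for \<open>x > f c\<close> all
    remaining labels lie below \<open>x\<close>, and for \<open>x \<le> f c \<le> b\<close> neither
    removed element was counted.\<close>
  have "lt_count (B - {#b#}) x \<le> lt_count (image_mset f (C - {#c#})) x" for x
  proof (cases "f c < x")
    case True
    then have "lt_count (image_mset f (C - {#c#})) x = size (image_mset f (C - {#c#}))"
      unfolding lt_count_eq_size_iff using fc by (auto dest: in_diffD intro: le_less_trans)
    also have "\<dots> = size (B - {#b#})"
      using Suc.prems(1) b(1) c(1) by (simp add: size_Diff_singleton)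
    finally show ?thesis using lt_count_le_size[of "B - {#b#}" x] by simp
  next
    case False
    have "lt_count B x = lt_count (B - {#b#}) x"
      using False cb lt_count_union[of "{#b#}" "B - {#b#}" x] B by (simp add: lt_count_def)
    moreover have "lt_count (image_mset f C) x = lt_count (image_mset f (C - {#c#})) x"
      using False lt_count_union[of "{#f c#}" "image_mset f (C - {#c#})" x]
      by (subst C) (simp add: lt_count_def)
    ultimately show ?thesis using Suc.prems(2)[of x] by simp
  qed
  moreover have "n = size (B - {#b#})" "size (C - {#c#}) = size (B - {#b#})"
    using Suc.hyps(2) Suc.prems(1) b(1) c(1) by (simp_all add: size_Diff_singleton)
  ultimately obtain P where "image_mset fst P = C - {#c#}" "image_mset snd P = B - {#b#}" "\<forall>(c, b)\<in>#P. f c \<le> b"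
    using Suc.hyps(1)[of "B - {#b#}" "C - {#c#}"] by blast
  then show ?case using B C cb by (intro exI[of _ "add_mset (c, b) P"]) auto
qed

lemma edges_snoc: "p \<noteq> [] \<Longrightarrow> edges (p @ [w]) = edges p @ [(last p, w)]"
proof (induction p)
  case (Cons a p)
  then show ?case by (cases p) (auto simp: edges_def)
qed simp

lemma snoc_path:
  assumes "up_right_path p" "unit_step (last p) w"
  shows "up_right_path (p @ [w])" "hd (edges (p @ [w])) = hd (edges p)"
proof -
  have "p \<noteq> []" using assms by (auto simp: up_right_path_def)
  then show "up_right_path (p @ [w])"
    using assms by (auto simp: up_right_path_def successively_append_iff)
  have "edges p \<noteq> []" using assms(1) by (cases p; cases "tl p") (auto simp: up_right_path_def edges_def)
  then show "hd (edges (p @ [w])) = hd (edges p)" using \<open>p \<noteq> []\<close> by (simp add: edges_snoc)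
qed

text \<open>The extension runs right and then one step up, so it adds no vertical edge below height
  \<open>y\<close> and leaves the earlier states unchanged.\<close>

lemma extend_path:
  assumes "up_right_path p" "last p = (x, y)" "x \<le> x'"
  shows "\<exists>p'. up_right_path p' \<and> hd (edges p') = hd (edges p) \<and> last (edges p') = ((x', y), (x', y + 1)) \<and>
    (\<forall>z h. h < y \<longrightarrow> vedge z h \<in> set (edges p') \<longleftrightarrow> vedge z h \<in> set (edges p))"
  using assms
proof (induction "nat (x' - x)" arbitrary: p x)
  case 0
  have "unit_step (last p) (x', y + 1)" using 0 by (simp add: unit_step_def)
  moreover have "p \<noteq> []" using 0 by (auto simp: up_right_path_def)
  ultimately show ?case
    using snoc_path[OF 0(2)] 0 by (intro exI[of _ "p @ [(x', y + 1)]"]) (auto simp: edges_snoc vedge_def)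
next
  case (Suc n)
  have "unit_step (last p) (x + 1, y)" using Suc by (simp add: unit_step_def)
  note * = snoc_path[OF Suc(3) this]
  have "p \<noteq> []" using Suc by (auto simp: up_right_path_def)
  have "n = nat (x' - (x + 1))" "x + 1 \<le> x'" using Suc by auto
  then obtain p' where "up_right_path p'" "hd (edges p') = hd (edges (p @ [(x + 1, y)]))"
    "last (edges p') = ((x', y), (x', y + 1))"
    "\<forall>z h. h < y \<longrightarrow> vedge z h \<in> set (edges p') \<longleftrightarrow> vedge z h \<in> set (edges (p @ [(x + 1, y)]))"
    using Suc.hyps(1)[of "x + 1" "p @ [(x + 1, y)]"] * by auto
  then show ?case using * \<open>p \<noteq> []\<close> Suc.prems(2) by (intro exI[of _ p']) (auto simp: edges_snoc vedge_def)
qed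

lemma start_edges_Suc:
  "start_edges b (Suc r) A = start_edges b r A + replicate_mset b (hedge 0 (int (Suc r)))"
proof -
  have "left_edges (Suc r) = add_mset (hedge 0 (int (Suc r))) (left_edges r)"
    by (simp add: left_edges_def hedge_def atLeastAtMostSuc_conv)
  then show ?thesis by (simp add: start_edges_def)
qed

text \<open>Paths are built one row at a time: admissibility is precisely the counting condition
  that allows the ends of the paths so far, together with the newly entering ones, to be matched
  with positions to their right in the next state.\<close>

lemma collection_exists:
  assumes "\<And>y. y < r \<Longrightarrow> admissible b (c y) (c (Suc y))"
  shows "\<exists>C\<in>collections (start_edges b r (c 0)) (end_edges r (c r)). \<forall>y\<le>r. vstate C y = c y"
  using assms
proof (induction r)
  case 0
  define C where "C = image_mset (\<lambda>x. [(int x, 0), (int x, 1)] :: vertex list) (c 0)"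
  have "C \<in> collections (start_edges b 0 (c 0)) (end_edges 0 (c 0))"
    by (auto simp: C_def collections_def start_edges_def end_edges_def left_edges_def up_right_path_def
        unit_step_def edges_def vedge_def image_mset.compositionality o_def)
  then show ?case using vstate_0 by auto
next
  case (Suc r)
  then obtain C where C: "C \<in> collections (start_edges b r (c 0)) (end_edges r (c r))"
    and vC: "\<And>y. y \<le> r \<Longrightarrow> vstate C y = c y" by auto
  have adm: "admissible b (c r) (c (Suc r))" using Suc.prems by simp
  \<comment> \<open>A path entering the new row from the left starts out as its first, horizontal
    edge alone.\<close>
  define stub :: "vertex list" where "stub = [(-1, int (Suc r)), (0, int (Suc r))]"
  define C0 where "C0 = C + replicate_mset b stub"
  \<comment> \<open>The last vertical edge of an old path already ends at height
    \<open>Suc r\<close>, so the path continues in the new row from column \<open>f p\<close>; a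
    stub has \<open>f stub = 0\<close>.\<close>
  define f where "f = (\<lambda>p :: vertex list. nat (fst (snd (last (edges p)))))"
  have lastC: "image_mset (\<lambda>p. last (edges p)) C = end_edges r (c r)" using C by (simp add: collections_def)
  have "image_mset f C = image_mset (\<lambda>e. nat (fst (snd e))) (image_mset (\<lambda>p. last (edges p)) C)"
    by (simp add: f_def image_mset.compositionality o_def)
  then have fC: "image_mset f C = c r"
    by (simp add: lastC end_edges_def image_mset.compositionality o_def vedge_def)
  have fC0: "image_mset f C0 = c r + replicate_mset b 0"
  proof -
    have "f stub = 0" by (simp add: f_def stub_def edges_def)
    then show ?thesis by (simp add: C0_def fC)
  qed
  have path0: "up_right_path p \<and> last p = (int (f p), int (Suc r))" if "p \<in># C0" for p
  proof (cases "p \<in># C")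
    case True
    note cp = collection_path[OF C True]
    have "last (edges p) \<in># end_edges r (c r)" using True lastC by (metis image_eqI set_image_mset)
    then obtain x where x: "last (edges p) = vedge x (int r)" by (auto simp: end_edges_def)
    moreover have "snd (last (edges p)) = last p" using path_hd_last[OF cp(1)] by simp
    ultimately have "last p = (int x, int (Suc r))" by (cases "last p") (auto simp: vedge_def)
    moreover have "f p = x" using x by (simp add: f_def vedge_def)
    ultimately show ?thesis using cp(1) by simp
  next
    case False
    then have "p = stub" using that by (auto simp: C0_def split: if_splits)
    then show ?thesis by (simp add: f_def stub_def edges_def up_right_path_def unit_step_def)
  qed
  have "size C0 = size (image_mset f C0)" by simp
  also have "\<dots> = size (c (Suc r))" unfolding fC0 using adm by (simp add: admissible_def)
  finally have "size C0 = size (c (Suc r))" .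
  moreover have "lt_count (c (Suc r)) x \<le> lt_count (image_mset f C0) x" for x
  proof (cases x)
    case (Suc y)
    then have "lt_count (replicate_mset b 0) x = b" using lt_count_eq_size_iff[of "replicate_mset b 0" x] by simp
    then show ?thesis using adm by (simp add: fC0 lt_count_union admissible_def add.commute)
  qed simp
  ultimately obtain P where P: "image_mset fst P = C0" "image_mset snd P = c (Suc r)" "\<forall>(p, x)\<in>#P. f p \<le> x"
    using monotone_matching by blast
  have "\<forall>px\<in>set_mset P. \<exists>p'. up_right_path p' \<and> hd (edges p') = hd (edges (fst px)) \<and>
     last (edges p') = vedge (snd px) (int (Suc r)) \<and>
    (\<forall>z h. h < int (Suc r) \<longrightarrow> vedge z h \<in> set (edges p') \<longleftrightarrow> vedge z h \<in> set (edges (fst px)))"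
  proof
    fix px assume px: "px \<in># P"
    then have "fst px \<in># C0" unfolding P(1)[symmetric] by simp
    then have "up_right_path (fst px)" "last (fst px) = (int (f (fst px)), int (Suc r))" using path0 by auto
    moreover have "int (f (fst px)) \<le> int (snd px)" using P(3) px by auto
    ultimately show "\<exists>p'. up_right_path p' \<and> hd (edges p') = hd (edges (fst px)) \<and>
       last (edges p') = vedge (snd px) (int (Suc r)) \<and>
      (\<forall>z h. h < int (Suc r) \<longrightarrow> vedge z h \<in> set (edges p') \<longleftrightarrow> vedge z h \<in> set (edges (fst px)))"
      unfolding vedge_def by (rule extend_path[unfolded vedge_def])
  qed
  from bchoice[OF this] obtain g where "\<forall>px\<in>#P. up_right_path (g px) \<and> hd (edges (g px)) = hd (edges (fst px)) \<and>
     last (edges (g px)) = vedge (snd px) (int (Suc r)) \<and>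
    (\<forall>z h. h < int (Suc r) \<longrightarrow> vedge z h \<in> set (edges (g px)) \<longleftrightarrow> vedge z h \<in> set (edges (fst px)))" ..
  then have g: "\<And>px. px \<in># P \<Longrightarrow> up_right_path (g px)"
    "\<And>px. px \<in># P \<Longrightarrow> hd (edges (g px)) = hd (edges (fst px))"
    "\<And>px. px \<in># P \<Longrightarrow> last (edges (g px)) = vedge (snd px) (int (Suc r))"
    "\<And>px z h. px \<in># P \<Longrightarrow> h < int (Suc r) \<Longrightarrow> vedge z h \<in> set (edges (g px)) \<longleftrightarrow> vedge z h \<in> set (edges (fst px))"
    by blast+
  define D where "D = image_mset g P"
  have "image_mset (\<lambda>p. hd (edges p)) D = image_mset (\<lambda>p. hd (edges p)) (image_mset fst P)"
    unfolding D_def image_mset.compositionality by (intro image_mset_cong) (simp add: g(2))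
  also have "\<dots> = start_edges b (Suc r) (c 0)"
    using C by (simp add: P(1) C0_def start_edges_Suc collections_def stub_def edges_def hedge_def)
  finally have hdD: "image_mset (\<lambda>p. hd (edges p)) D = start_edges b (Suc r) (c 0)" .
  have "image_mset (\<lambda>p. last (edges p)) D = image_mset (\<lambda>x. vedge x (int (Suc r))) (image_mset snd P)"
    unfolding D_def image_mset.compositionality by (intro image_mset_cong) (simp add: g(3))
  then have D: "D \<in> collections (start_edges b (Suc r) (c 0)) (end_edges (Suc r) (c (Suc r)))"
    using hdD g(1) by (auto simp: collections_def end_edges_def P(2) D_def)
  have "vstate D y = c y" if "y \<le> r" for y
  proof (rule multiset_eqI)
    fix x
    have "num_through D (vedge x (int y)) = (\<Sum>px\<in>#P. of_bool (vedge x (int y) \<in> set (edges (fst px))))"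
      unfolding num_through_eq_sum D_def image_mset.compositionality using that
      by (intro arg_cong[of _ _ sum_mset] image_mset_cong) (simp add: g(4))
    also have "\<dots> = num_through (image_mset fst P) (vedge x (int y))"
      unfolding num_through_eq_sum image_mset.compositionality o_def ..
    also have "\<dots> = num_through C (vedge x (int y))"
      by (simp add: P(1) C0_def num_through_def stub_def edges_def vedge_def)
    also have "\<dots> = count (c y) x" using vC[OF that] count_vstate[of C y x] by simp
    finally show "count (vstate D y) x = count (c y) x" by (simp add: count_vstate)
  qed
  then have "\<forall>y\<le>Suc r. vstate D y = c y" using vstate_top[OF D] by (auto simp: le_Suc_eq)
  then show ?case using D by blast
qed

lemma local_data_collections:
  "local_data ` collections (start_edges b r A) (end_edges r B) = config b r ` state_seqs b r A B"
proof (intro equalityI subsetI)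
  fix d assume "d \<in> local_data ` collections (start_edges b r A) (end_edges r B)"
  then obtain C where C: "C \<in> collections (start_edges b r A) (end_edges r B)" "d = local_data C" by blast
  \<comment> \<open>Resetting the values above \<open>r\<close> yields the normal form of
    \<open>state_seqs\<close>; \<open>config\<close> reads only the states up to
    \<open>r\<close>.\<close>
  define c where "c = (\<lambda>y. if y \<le> r then vstate C y else {#})"
  have "c \<in> state_seqs b r A B"
    using vstate_0[OF C(1)] vstate_top[OF C(1)] admissible_vstate[OF C(1)]
    by (auto simp: state_seqs_def c_def)
  moreover have "d = config b r c"
    unfolding C(2) local_data_eq_config[OF C(1)] by (rule config_cong) (simp add: c_def)
  ultimately show "d \<in> config b r ` state_seqs b r A B" by blast
next
  fix d assume "d \<in> config b r ` state_seqs b r A B"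
  then obtain c where c: "c \<in> state_seqs b r A B" "d = config b r c" by blast
  then have "\<And>y. y < r \<Longrightarrow> admissible b (c y) (c (Suc y))" by (simp add: state_seqs_def)
  from collection_exists[of r b c, OF this] obtain C where
    C: "C \<in> collections (start_edges b r A) (end_edges r B)" "\<forall>y\<le>r. vstate C y = c y"
    using c(1) unfolding state_seqs_def by blast
  have "local_data C = d"
    unfolding c(2) local_data_eq_config[OF C(1)] by (rule config_cong) (simp add: C(2))
  then show "d \<in> local_data ` collections (start_edges b r A) (end_edges r B)" using C(1) by blast
qed

section \<open>Weights of configurations and transfer kernels\<close>

lemma weight_config:
  assumes c: "c \<in> state_seqs b r A B" and u: "\<And>i. i \<in> {1..r} \<Longrightarrow> 1 - s * u i \<noteq> 0"
  shows "weight q s u (config b r c) =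
    (\<Prod>y<r. row_weight (vertex_weight q s (u (Suc y))) b (c y) (c (Suc y)))"
proof -
  define n where "n = Suc (sum_mset B)"
  have adm: "admissible b (c y) (c (Suc y))" if "y < r" for y using c that by (simp add: state_seqs_def)
  have supp: "set_mset (c y) \<subseteq> {..<n}" if "y \<le> r" for y
    using that
  proof (induction y rule: inc_induct)
    case base
    then show ?case using c subset_sum_mset[of B] by (simp add: state_seqs_def n_def)
  next
    case (step y)
    then show ?case using admissible_support[OF adm] by simp
  qed
  define t where "t = (\<lambda>x y. (count (c y) x, flux b (c y) (c (Suc y)) x, count (c (Suc y)) x, flux b (c y) (c (Suc y)) (Suc x)))"
  define w where "w = (\<lambda>x y. case t x y of (i1, j1, i2, j2) \<Rightarrow> vertex_weight q s (u (Suc y)) i1 j1 i2 j2)"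
  let ?h = "\<lambda>(x, y). (int x, int (Suc y)) :: vertex"
  have cfg: "config b r c (int x, int (Suc y)) = (if t x y \<noteq> (0, 0, 0, 0) then Some (t x y) else None)"
    if "y < r" for x y
  proof -
    have n: "nat (int (Suc y) - 1) = y" "nat (int (Suc y)) = Suc y" "nat (int x) = x" by simp_all
    have "0 \<le> int x \<and> 1 \<le> int (Suc y) \<and> int (Suc y) \<le> int r" using that by simp
    then show ?thesis unfolding config_def prod.case Let_def t_def n by simp
  qed
  have dom: "dom (config b r c) \<subseteq> ?h ` ({..<n} \<times> {..<r})"
  proof
    fix v assume "v \<in> dom (config b r c)"
    then obtain x y where v: "v = (x, y)" and ne: "config b r c (x, y) \<noteq> None" by (cases v) auto
    have "0 \<le> x \<and> 1 \<le> y \<and> y \<le> int r"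
    proof (rule ccontr)
      assume "\<not> ?thesis"
      then have "config b r c (x, y) = None" unfolding config_def prod.case Let_def by auto
      then show False using ne by simp
    qed
    then have xy: "x = int (nat x)" "y = int (Suc (nat (y - 1)))" "nat (y - 1) < r" by auto
    then have "t (nat x) (nat (y - 1)) \<noteq> (0, 0, 0, 0)"
      using ne cfg[OF xy(3), of "nat x"] unfolding xy(1,2)[symmetric] by auto
    moreover have "t x y = (0, 0, 0, 0)" if "n \<le> x" "y < r" for x y
    proof -
      have "set_mset (c y) \<subseteq> {..<x}" "set_mset (c (Suc y)) \<subseteq> {..<x}" "set_mset (c (Suc y)) \<subseteq> {..<Suc x}"
        using supp[of y] supp[of "Suc y"] that by auto
      then show ?thesis using flux_eq_0[OF adm[OF that(2)]]
        by (auto simp: t_def count_eq_zero_iff)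
    qed
    ultimately have "nat x < n" using xy(3) by (meson not_le_imp_less)
    then show "v \<in> ?h ` ({..<n} \<times> {..<r})" using xy v by (intro image_eqI[of _ _ "(nat x, nat (y - 1))"]) auto
  qed
  \<comment> \<open>A vertex outside the domain is touched by no path and an empty vertex has weight
    1, so the product extends to the full rectangle, which then factors into rows.\<close>
  have "weight q s u (config b r c) = (\<Prod>v\<in>?h ` ({..<n} \<times> {..<r}). case v of (x, y) \<Rightarrow> w (nat x) (nat (y - 1)))"
    unfolding weight_def
  proof (rule prod.mono_neutral_cong_left[OF _ dom])
    show "\<forall>v\<in>?h ` ({..<n} \<times> {..<r}) - dom (config b r c). (case v of (x, y) \<Rightarrow> w (nat x) (nat (y - 1))) = 1"
    proof
      fix v assume "v \<in> ?h ` ({..<n} \<times> {..<r}) - dom (config b r c)"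
      then obtain x y where v: "v = (int x, int (Suc y))" "y < r" and "config b r c v = None" by auto
      then have "t x y = (0, 0, 0, 0)" using cfg[of y x] by (metis option.distinct(1))
      moreover have "1 - s * u (Suc y) \<noteq> 0" using u \<open>y < r\<close> by simp
      ultimately have "w x y = 1" by (simp add: w_def vertex_weight_def)
      then show "(case v of (x, y) \<Rightarrow> w (nat x) (nat (y - 1))) = 1" by (simp add: v(1))
    qed
    fix v assume v: "v \<in> dom (config b r c)"
    then obtain x y where xy: "v = (int x, int (Suc y))" "y < r" using dom by auto
    then have "config b r c v = Some (t x y)" using v cfg[of y x] by (metis domIff)
    then show "(case the (config b r c v) of (i1, j1, i2, j2) \<Rightarrow>
        vertex_weight q s (u (nat (snd v))) i1 j1 i2 j2) = (case v of (x, y) \<Rightarrow> w (nat x) (nat (y - 1)))"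
      using xy(1) by (simp add: w_def nat_add_distrib add.commute)
  qed simp
  also have "\<dots> = (\<Prod>(x, y)\<in>{..<n} \<times> {..<r}. w x y)"
    by (subst prod.reindex) (auto simp: inj_on_def intro!: prod.cong)
  also have "\<dots> = (\<Prod>y<r. \<Prod>x<n. w x y)"
    by (simp add: prod.cartesian_product[symmetric] prod.swap[of _ "{..<n}"])
  also have "\<dots> = (\<Prod>y<r. row_weight (vertex_weight q s (u (Suc y))) b (c y) (c (Suc y)))"
  proof (rule prod.cong[OF refl])
    fix y assume y: "y \<in> {..<r}"
    then have "vertex_weight q s (u (Suc y)) 0 0 0 0 = 1" using u[of "Suc y"] by (simp add: vertex_weight_def)
    then show "(\<Prod>x<n. w x y) = row_weight (vertex_weight q s (u (Suc y))) b (c y) (c (Suc y))"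
      using y row_eq[OF adm supp, of y "vertex_weight q s (u (Suc y))"] by (simp add: w_def t_def)
  qed
  finally show ?thesis .
qed

text \<open>A sequence ending in \<open>B\<close> corresponds to its state \<open>C\<close> under
  the top row together with the shorter sequence ending in \<open>C\<close>, where the entry at
  \<open>Suc r\<close> is reset to the default.\<close>

lemma sum_state_seqs:
  "finite (state_seqs b r A B) \<and>
   (\<Sum>c\<in>state_seqs b r A B. \<Prod>y<r. row_weight (W (Suc y)) b (c y) (c (Suc y))) = transfer_kernel W b r A B"
proof (induction r arbitrary: B)
  case 0
  have "state_seqs b 0 A B = (if A = B then {\<lambda>y. if y = 0 then A else {#}} else {})"
    by (auto simp: state_seqs_def fun_eq_iff)
  then show ?case by simp
next
  case (Suc r)
  let ?w = "\<lambda>r c. \<Prod>y<r. row_weight (W (Suc y)) b (c y) (c (Suc y))"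
  let ?S = "Sigma (below b B) (state_seqs b r A)"
  let ?i = "\<lambda>(C, c). c(Suc r := B)" and ?j = "\<lambda>c. (c r, c(Suc r := {#}))"
  have 1: "?j (?i x) = x" "?i x \<in> state_seqs b (Suc r) A B"
    "?w (Suc r) (?i x) = ?w r (snd x) * row_weight (W (Suc r)) b (fst x) B" if xS: "x \<in> ?S" for x
  proof -
    obtain C c where x: "x = (C, c)" "admissible b C B" "c \<in> state_seqs b r A C"
      using xS by (auto simp: below_def)
    have c: "c 0 = A" "c r = C" "\<And>y. y < r \<Longrightarrow> admissible b (c y) (c (Suc y))" "\<And>y. y > r \<Longrightarrow> c y = {#}"
      using x(3) by (auto simp: state_seqs_def)
    have "c(Suc r := {#}) = c" using c(4)[of "Suc r"] fun_upd_triv[of c "Suc r"] by simp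
    then show "?j (?i x) = x" using x(1) c(2) by simp
    show "?i x \<in> state_seqs b (Suc r) A B"
      using x c by (auto simp: state_seqs_def less_Suc_eq)
    show "?w (Suc r) (?i x) = ?w r (snd x) * row_weight (W (Suc r)) b (fst x) B"
    proof -
      have "?w r (c(Suc r := B)) = ?w r c" by (rule prod.cong) auto
      then show ?thesis by (simp add: x(1) c(2))
    qed
  qed
  have 2: "?i (?j c) = c" "?j c \<in> ?S" if "c \<in> state_seqs b (Suc r) A B" for c
  proof -
    have c: "c 0 = A" "c (Suc r) = B" "\<And>y. y < Suc r \<Longrightarrow> admissible b (c y) (c (Suc y))"
      "\<And>y. y > Suc r \<Longrightarrow> c y = {#}"
      using that by (auto simp: state_seqs_def)
    show "?i (?j c) = c" using c(2) by auto
    have "c(Suc r := {#}) \<in> state_seqs b r A (c r)"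
      unfolding state_seqs_def using c by (auto simp: less_Suc_eq)
    then show "?j c \<in> ?S" using c(2) c(3)[of r] by (simp add: below_def)
  qed
  have fin: "finite ?S" by (intro finite_SigmaI finite_below) (use Suc in blast)
  have "state_seqs b (Suc r) A B \<subseteq> ?i ` ?S"
  proof
    fix c assume c: "c \<in> state_seqs b (Suc r) A B"
    show "c \<in> ?i ` ?S"
      by (rule image_eqI[where x = "?j c"]) (simp_all only: 2[OF c])
  qed
  then have "finite (state_seqs b (Suc r) A B)" using fin by (meson finite_imageI finite_subset)
  moreover have "(\<Sum>x\<in>?S. ?w r (snd x) * row_weight (W (Suc r)) b (fst x) B) =
      (\<Sum>c\<in>state_seqs b (Suc r) A B. ?w (Suc r) c)"
    by (rule sum.reindex_bij_witness[of _ ?j ?i]) (use 1 2 in \<open>simp_all only:\<close>)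
  moreover have "(\<Sum>x\<in>?S. ?w r (snd x) * row_weight (W (Suc r)) b (fst x) B) =
      (\<Sum>C\<in>below b B. (\<Sum>c\<in>state_seqs b r A C. ?w r c) * row_weight (W (Suc r)) b C B)"
    unfolding sum_distrib_right
    by (subst sum.Sigma) (use Suc finite_below in \<open>simp_all add: case_prod_unfold\<close>)
  moreover have "(\<Sum>c\<in>state_seqs b r A C. ?w r c) = transfer_kernel W b r A C" for C
    using Suc by blast
  ultimately show ?case by simp
qed

lemma partition_function_eq_transfer:
  assumes "\<And>i. i \<in> {1..r} \<Longrightarrow> 1 - s * u i \<noteq> 0"
  shows "partition_function q s u (start_edges b r A) (end_edges r B) =
    transfer_kernel (\<lambda>i. vertex_weight q s (u i)) b r A B"
proof -
  have "partition_function q s u (start_edges b r A) (end_edges r B) =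
      (\<Sum>c\<in>state_seqs b r A B. weight q s u (config b r c))"
    unfolding partition_function_def local_data_collections by (simp add: sum.reindex inj_config)
  also have "\<dots> = (\<Sum>c\<in>state_seqs b r A B. \<Prod>y<r. row_weight (vertex_weight q s (u (Suc y))) b (c y) (c (Suc y)))"
    by (intro sum.cong refl weight_config assms)
  finally show ?thesis using sum_state_seqs[of b r A B "\<lambda>i. vertex_weight q s (u i)"] by simp
qed

section \<open>The skew Cauchy identity\<close>

definition state :: "int list \<Rightarrow> nat multiset" where
  "state lam = mset (map nat lam)"

lemma size_state: "size (state lam) = length lam"
  by (simp add: state_def)

lemma image_int_state:
  assumes "\<forall>x\<in>set lam. 0 \<le> x"
  shows "image_mset int (state lam) = mset lam"
  unfolding state_def mset_map image_mset.compositionality o_def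
  using assms by (subst image_mset_cong[of _ _ "\<lambda>x. x"]) auto

text \<open>A weakly decreasing list is determined by its multiset, so a sum over nonnegative
  signatures of all lengths is a sum over all finite multisets of naturals.\<close>

lemma bij_betw_state: "bij_betw state nonneg_signatures UNIV"
proof (rule bij_betw_imageI)
  have rev: "sorted (rev lam)" if "lam \<in> nonneg_signatures" for lam
    using that by (auto simp: nonneg_signatures_def signatures_def sorted_wrt_rev)
  show "inj_on state nonneg_signatures"
  proof (rule inj_onI)
    fix lam mu assume *: "lam \<in> nonneg_signatures" "mu \<in> nonneg_signatures" "state lam = state mu"
    have "mset lam = mset mu"
      using * image_int_state[of lam] image_int_state[of mu] by (auto simp: nonneg_signatures_def)
    then have "rev lam = rev mu"
      using rev[OF *(1)] rev[OF *(2)] by (metis mset_rev properties_for_sort)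
    then show "lam = mu" by simp
  qed
  have "A \<in> state ` nonneg_signatures" for A
  proof (rule image_eqI)
    let ?l = "map int (rev (sorted_list_of_multiset A))"
    show "A = state ?l" by (simp add: state_def o_def)
    have "sorted_wrt (\<lambda>x y. int x \<ge> int y) (rev (sorted_list_of_multiset A))"
      by (simp add: sorted_wrt_rev)
    then show "?l \<in> nonneg_signatures"
      by (auto simp: nonneg_signatures_def signatures_def sorted_wrt_map)
  qed
  then show "state ` nonneg_signatures = UNIV" by blast
qed

lemma vertical_edges_eq:
  assumes "\<forall>x\<in>set lam. 0 \<le> x"
  shows "vertical_edges lam y = image_mset (\<lambda>x. vedge x y) (state lam)"
  unfolding vertical_edges_def image_int_state[OF assms, symmetric]
  by (simp add: image_mset.compositionality o_def vedge_def)

definition conj_state :: "complex \<Rightarrow> complex \<Rightarrow> nat multiset \<Rightarrow> complex" where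
  "conj_state q s A = Prod_any (\<lambda>k. q_pochhammer (s\<^sup>2) q (count A k) / q_pochhammer q q (count A k))"

lemma row_weight_conj:
  assumes gen: "generic q s" and u: "1 - s * u \<noteq> 0"
  shows "row_weight (conj_weight q s u) b A B = conj_state q s B / conj_state q s A * row_weight (vertex_weight q s u) b A B"
    and "conj_state q s A \<noteq> 0"
proof -
  define g where "g = (\<lambda>n. q_pochhammer (s\<^sup>2) q n / q_pochhammer q q n)"
  have g: "g 0 = 1" "g n \<noteq> 0" for n
    using q_pochhammer_nonzero[OF gen] by (simp_all add: g_def q_pochhammer_def)
  have h: "conj_state q s A = (\<Prod>k<n. g (count A k))" if "set_mset A \<subseteq> {..<n}" for A n
  proof -
    have "{k. g (count A k) \<noteq> 1} \<subseteq> {..<n}"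
      using g(1) that by (auto simp: subset_iff) (metis not_in_iff)
    then show ?thesis unfolding conj_state_def by (subst Prod_any.expand_superset[of "{..<n}"]) (auto simp: g_def)
  qed
  show "conj_state q s A \<noteq> 0" using h[OF subset_sum_mset[of A]] g(2) by simp
  show "row_weight (conj_weight q s u) b A B = conj_state q s B / conj_state q s A * row_weight (vertex_weight q s u) b A B"
  proof (cases "admissible b A B")
    case True
    have B: "set_mset B \<subseteq> {..<Suc (sum_mset B)}" by (rule subset_sum_mset)
    show ?thesis
      unfolding row_eq[of b A B _ "vertex_weight q s u", OF True B vertex_weight_empty[OF u]]
        row_eq[of b A B _ "conj_weight q s u", OF True B conj_weight_empty[OF u]]
        h[OF B] h[OF admissible_support[OF True B]]
      by (simp add: conj_weight_def g_def prod.distrib prod_dividef)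
  qed (simp add: row_weight_def)
qed

text \<open>The factors telescope through the intermediate states: \<open>conj_state q s C\<close>
  cancels between consecutive rows since it is nonzero.\<close>

lemma transfer_kernel_conj:
  assumes gen: "generic q s" and u: "\<And>i. i \<in> {1..r} \<Longrightarrow> 1 - s * u i \<noteq> 0"
  shows "transfer_kernel (\<lambda>i. conj_weight q s (u i)) b r A B =
    conj_state q s B / conj_state q s A * transfer_kernel (\<lambda>i. vertex_weight q s (u i)) b r A B"
proof -
  \<comment> \<open>The nonvanishing of \<open>conj_state\<close> does not involve \<open>u\<close>;
    it is obtained by instantiating the parameter with 0.\<close>
  have "1 - s * 0 \<noteq> 0" by simp
  note h0 = row_weight_conj(2)[OF gen this]
  show ?thesis using u
  proof (induction r arbitrary: B)
    case 0
    then show ?case using h0 by simp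
  next
    case (Suc r)
    have "transfer_kernel (\<lambda>i. conj_weight q s (u i)) b r A C * row_weight (conj_weight q s (u (Suc r))) b C B =
      conj_state q s B / conj_state q s A * (transfer_kernel (\<lambda>i. vertex_weight q s (u i)) b r A C * row_weight (vertex_weight q s (u (Suc r))) b C B)"
      for C
      using Suc.IH[of C] Suc.prems row_weight_conj(1)[OF gen Suc.prems[of "Suc r"], of b C B] h0[of C]
      by simp
    then show ?case by (simp add: sum_distrib_left)
  qed
qed

text \<open>Matches the convention that F and G vanish when the lengths of the signatures do not
  fit.\<close>

lemma transfer_kernel_size: "transfer_kernel W b r A B \<noteq> 0 \<Longrightarrow> size B = size A + b * r"
proof (induction r arbitrary: B)
  case 0
  then show ?case by (auto split: if_splits)
next
  case (Suc r)
  then obtain C where "transfer_kernel W b r A C * row_weight (W (Suc r)) b C B \<noteq> 0"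
    unfolding transfer_kernel.simps by (meson sum.not_neutral_contains_not_neutral)
  then show ?case using Suc.IH[of C] row_size[of "W (Suc r)" b C B] by auto
qed

lemma F_skew_eq_transfer:
  assumes "\<And>i. i \<in> {1..r} \<Longrightarrow> 1 - s * u i \<noteq> 0" "lam \<in> nonneg_signatures" "mu \<in> nonneg_signatures"
  shows "F_skew q s r u lam mu = transfer_kernel (\<lambda>i. vertex_weight q s (u i)) 1 r (state mu) (state lam)"
proof (cases "length lam = length mu + r")
  case True
  have nonneg: "\<forall>x\<in>set lam. 0 \<le> x" "\<forall>x\<in>set mu. 0 \<le> x" using assms by (auto simp: nonneg_signatures_def)
  have "vertical_edges mu 0 + left_edges r = start_edges 1 r (state mu)"
    "vertical_edges lam (int r) = end_edges r (state lam)"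
    using nonneg by (simp_all add: vertical_edges_eq start_edges_def end_edges_def)
  then show ?thesis
    using True partition_function_eq_transfer[OF assms(1), where b = 1 and q = q and A = "state mu" and B = "state lam"]
    by (simp add: F_skew_def)
next
  case False
  then show ?thesis
    using transfer_kernel_size[of _ 1 r "state mu" "state lam"] by (auto simp: F_skew_def size_state)
qed

lemma G_conj_eq_transfer:
  assumes gen: "generic q s" and u: "\<And>i. i \<in> {1..r} \<Longrightarrow> 1 - s * u i \<noteq> 0"
    and "lam \<in> nonneg_signatures" "mu \<in> nonneg_signatures"
  shows "G_conj q s r u lam mu = transfer_kernel (\<lambda>i. conj_weight q s (u i)) 0 r (state mu) (state lam)"
proof -
  have nonneg: "\<forall>x\<in>set lam. 0 \<le> x" "\<forall>x\<in>set mu. 0 \<le> x" using assms by (auto simp: nonneg_signatures_def)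
  have "G_skew q s r u lam mu = transfer_kernel (\<lambda>i. vertex_weight q s (u i)) 0 r (state mu) (state lam)"
  proof (cases "length lam = length mu")
    case True
    have "vertical_edges mu 0 = start_edges 0 r (state mu)" "vertical_edges lam (int r) = end_edges r (state lam)"
      using nonneg by (simp_all add: vertical_edges_eq start_edges_def end_edges_def)
    then show ?thesis
      using True partition_function_eq_transfer[OF u, where b = 0 and q = q and A = "state mu" and B = "state lam"]
      by (simp add: G_skew_def)
  next
    case False
    then show ?thesis
      using transfer_kernel_size[of _ 0 r "state mu" "state lam"] by (auto simp: G_skew_def size_state)
  qed
  moreover have "count_list lam (int k) = count (state lam) k" if "\<forall>x\<in>set lam. 0 \<le> x" for lam k
    using that by (induction lam) (auto simp: state_def)
  then have "conj_factor q s lam = conj_state q s (state lam)"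
    "conj_factor q s mu = conj_state q s (state mu)"
    using nonneg by (simp_all add: conj_factor_def conj_state_def)
  moreover have "transfer_kernel (\<lambda>i. conj_weight q s (u i)) 0 r (state mu) (state lam) =
      conj_state q s (state lam) / conj_state q s (state mu) *
      transfer_kernel (\<lambda>i. vertex_weight q s (u i)) 0 r (state mu) (state lam)"
    using gen u by (rule transfer_kernel_conj)
  ultimately show ?thesis by (simp add: G_conj_def)
qed

theorem corollary4p4:
  fixes q s :: complex and M N :: nat and u v :: "nat \<Rightarrow> complex" and lam mu :: "int list"
  assumes "generic q s"
    and "\<And>i. i \<in> {1..M} \<Longrightarrow> 1 - s * u i \<noteq> 0"
    and "\<And>j. j \<in> {1..N} \<Longrightarrow> 1 - s * v j \<noteq> 0"
    and "\<And>i j. i \<in> {1..M} \<Longrightarrow> j \<in> {1..N} \<Longrightarrow> 1 - u i * v j \<noteq> 0"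
    and "\<And>i j. i \<in> {1..M} \<Longrightarrow> j \<in> {1..N} \<Longrightarrow>
           norm ((u i - s) / (1 - s * u i) * ((v j - s) / (1 - s * v j))) < 1"
    and "lam \<in> nonneg_signatures" and "mu \<in> nonneg_signatures"
  shows "(\<lambda>nu. F_skew q s M u nu lam * G_conj q s N v nu mu) summable_on nonneg_signatures \<and>
    (\<lambda>kappa. G_conj q s N v lam kappa * F_skew q s M u mu kappa) summable_on nonneg_signatures \<and>
    (\<Sum>\<^sub>\<infinity>nu\<in>nonneg_signatures. F_skew q s M u nu lam * G_conj q s N v nu mu) =
      (\<Prod>i=1..M. \<Prod>j=1..N. (1 - q * u i * v j) / (1 - u i * v j)) *
      (\<Sum>\<^sub>\<infinity>kappa\<in>nonneg_signatures. G_conj q s N v lam kappa * F_skew q s M u mu kappa)"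
proof -
  let ?F = "transfer_kernel (\<lambda>i. vertex_weight q s (u i)) 1 M"
  let ?G = "transfer_kernel (\<lambda>j. conj_weight q s (v j)) 0 N"
  have F: "F_skew q s M u nu kappa = ?F (state kappa) (state nu)"
    if "nu \<in> nonneg_signatures" "kappa \<in> nonneg_signatures" for nu kappa
    using F_skew_eq_transfer[OF assms(2) that] .
  have G: "G_conj q s N v nu kappa = ?G (state kappa) (state nu)"
    if "nu \<in> nonneg_signatures" "kappa \<in> nonneg_signatures" for nu kappa
    using G_conj_eq_transfer[OF assms(1,3) that] .
  note cauchy = skew_cauchy_transfer[where lam = "state lam" and mu = "state mu", OF assms(1-5)]
  have "(\<lambda>nu. ?F (state lam) (state nu) * ?G (state mu) (state nu)) summable_on nonneg_signatures"
    using cauchy(1) summable_on_reindex_bij_betw[OF bij_betw_state, of "\<lambda>C. ?F (state lam) C * ?G (state mu) C"]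
    by simp
  moreover have "(\<lambda>kappa. ?G (state kappa) (state lam) * ?F (state kappa) (state mu)) summable_on nonneg_signatures"
    using cauchy(2) summable_on_reindex_bij_betw[OF bij_betw_state, of "\<lambda>C. ?G C (state lam) * ?F C (state mu)"]
    by simp
  moreover have "(\<Sum>\<^sub>\<infinity>nu\<in>nonneg_signatures. ?F (state lam) (state nu) * ?G (state mu) (state nu)) =
      (\<Prod>i=1..M. \<Prod>j=1..N. (1 - q * u i * v j) / (1 - u i * v j)) *
      (\<Sum>\<^sub>\<infinity>kappa\<in>nonneg_signatures. ?G (state kappa) (state lam) * ?F (state kappa) (state mu))"
    using cauchy(3) infsum_reindex_bij_betw[OF bij_betw_state, of "\<lambda>C. ?F (state lam) C * ?G (state mu) C"]
      infsum_reindex_bij_betw[OF bij_betw_state, of "\<lambda>C. ?G C (state lam) * ?F C (state mu)"]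
    by simp
  ultimately show ?thesis
    using assms(6,7) by (simp add: F G cong: summable_on_cong infsum_cong)
qed

end
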